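(* Let $H_C\subseteq\mathfrak g_C$ be a type C Hessenberg space and let $H\subseteq\mathfrak{sl}_{2n}(\mathbb C)$ be the subspace constructed from it as described in the context. Then: (1) $H$ is a type A Hessenberg space, i.e. $[\mathfrak b,H]\subseteq H$, and $H^\sigma=H_C$; (2) for every $x\in\mathfrak g_C$, $\phi'(\mathcal B_C(x,H_C))=\mathcal B_A(x,H)^\sigma$.
   Context: Let $J$ be the $n\times n$ antidiagonal matrix of $1$'s and $E=\begin{bmatrix}0&J\\-J&0\end{bmatrix}$. Let $\sigma$ be the involution of $SL_{2n}(\mathbb C)$, $\sigma(A)=E(A^{\mathsf{tr}})^{-1}E^{-1}$, and also its differential on $\mathfrak{sl}_{2n}(\mathbb C)$, $\sigma(x)=Ex^{\mathsf{tr}}E$. Set $G_C=SL_{2n}(\mathbb C)^\sigma\cong Sp_{2n}(\mathbb C)$ and $\mathfrak g_C=\mathfrak{sl}_{2n}(\mathbb C)^\sigma$. Let $B$ (resp. $T$) be upper triangular (resp. diagonal) matrices in $SL_{2n}(\mathbb C)$, with Lie algebras $\mathfrak b$, $\mathfrak h$; $B_C=B^\sigma$, $\mathfrak b_C=\mathfrak b^\sigma$, $\mathfrak h^\sigma=\{\mathrm{diag}(d_1,\dots,d_{2n}):d_i=-d_{2n+1-i}\}$. Write $i'=2n+1-i$ and $h_{ij}=E_{ii}-E_{jj}$. A type A Hessenberg space is a subspace $H\subseteq\mathfrak{sl}_{2n}(\mathbb C)$ with $[\mathfrak b,H]\subseteq H$; a type C Hessenberg space is a subspace $H_C\subseteq\mathfrak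 g_C$ with $[\mathfrak b_C,H_C]\subseteq H_C$. For $i\ne j$, the restriction of $\varepsilon_i-\varepsilon_j$ to $\mathfrak h^\sigma$ is a root of $\mathfrak g_C$ (with respect to $\mathfrak h^\sigma$), and its root space is spanned by $E_{ij}+\sigma(E_{ij})$. Define $\Phi_H$ as the set of $\varepsilon_i-\varepsilon_j$ ($i\neq j$) such that the root space of $\mathfrak g_C$ for $(\varepsilon_i-\varepsilon_j)|_{\mathfrak h^\sigma}$ is contained in $H_C$. Define $H=(H\cap\mathfrak h)\oplus\bigoplus_{\varepsilon_i-\varepsilon_j\in\Phi_H}\mathbb CE_{ij}$, where $H\cap\mathfrak h$ is the span of $H_C\cap\mathfrak h^\sigma$ together with all $h_{ij}$ such that both $\varepsilon_i-\varepsilon_j$ and $\varepsilon_j-\varepsilon_i$ lie in $\Phi_H$. Let $\mathcal B_A=SL_{2n}(\mathbb C)/B$, on which $\sigma$ acts by $gB\mapsto\sigma(g)B$, and $\mathcal B_C=G_C/B_C$; $\phi':\mathcal B_C\to\mathcal B_A$, $gB_C\mapsto gB$. Adjoint Hessenberg varieties: $\mathcal B_A(x,H)=\{gB:g^{-1}xg\in H\}$, $\mathcal B_C(x,H_C)=\{gB_C: g\in G_C,\ g^{-1}xg\in H_C\}$. *)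

theory Defs
  imports "Jordan_Normal_Form.Determinant"
begin

(* Conventions: indices are 0-based, 0..2n-1; the paper's i' = 2n+1-i becomes 2n-1-i.
   Matrices are Jordan_Normal_Form matrices of type complex mat. *)

definition Jmat :: "nat \<Rightarrow> complex mat" where
  "Jmat n = mat n n (\<lambda>(i,j). if i + j = n - 1 then 1 else 0)"

definition Emat :: "nat \<Rightarrow> complex mat" where
  "Emat n = mat (2*n) (2*n) (\<lambda>(i,j).
     if i < n \<and> n \<le> j then Jmat n $$ (i, j - n)
     else if n \<le> i \<and> j < n then - (Jmat n $$ (i - n, j))
     else 0)"

definition minv :: "complex mat \<Rightarrow> complex mat" where
  "minv A = (SOME B. B \<in> carrier_mat (dim_row A) (dim_row A) \<and>
                     A * B = 1\<^sub>m (dim_row A) \<and> B * A = 1\<^sub>m (dim_row A))"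

definition mtrace :: "complex mat \<Rightarrow> complex" where
  "mtrace A = (\<Sum>i<dim_row A. A $$ (i,i))"

definition sigma_grp :: "nat \<Rightarrow> complex mat \<Rightarrow> complex mat" where
  "sigma_grp n A = Emat n * minv (transpose_mat A) * minv (Emat n)"

definition sigma_alg :: "nat \<Rightarrow> complex mat \<Rightarrow> complex mat" where
  "sigma_alg n x = Emat n * transpose_mat x * Emat n"

definition SL :: "nat \<Rightarrow> complex mat set" where
  "SL n = {A \<in> carrier_mat (2*n) (2*n). det A = 1}"

definition sl :: "nat \<Rightarrow> complex mat set" where
  "sl n = {x \<in> carrier_mat (2*n) (2*n). mtrace x = 0}"

definition Bor :: "nat \<Rightarrow> complex mat set" where
  "Bor n = {A \<in> SL n. upper_triangular A}"

definition bor :: "nat \<Rightarrow> complex mat set" where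
  "bor n = {x \<in> sl n. upper_triangular x}"

definition GC :: "nat \<Rightarrow> complex mat set" where
  "GC n = {A \<in> SL n. sigma_grp n A = A}"

definition gC :: "nat \<Rightarrow> complex mat set" where
  "gC n = {x \<in> sl n. sigma_alg n x = x}"

definition BC :: "nat \<Rightarrow> complex mat set" where
  "BC n = {A \<in> Bor n. sigma_grp n A = A}"

definition bC :: "nat \<Rightarrow> complex mat set" where
  "bC n = {x \<in> bor n. sigma_alg n x = x}"

definition hsig :: "nat \<Rightarrow> complex mat set" where
  "hsig n = {x \<in> carrier_mat (2*n) (2*n). diagonal_mat x \<and>
               (\<forall>i < 2*n. x $$ (i,i) = - x $$ (2*n - 1 - i, 2*n - 1 - i))}"

definition bracket :: "complex mat \<Rightarrow> complex mat \<Rightarrow> complex mat" where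
  "bracket x y = x * y - y * x"

definition is_msubspace :: "nat \<Rightarrow> complex mat set \<Rightarrow> bool" where
  "is_msubspace N V \<longleftrightarrow> V \<subseteq> carrier_mat N N \<and> 0\<^sub>m N N \<in> V \<and>
     (\<forall>x\<in>V. \<forall>y\<in>V. x + y \<in> V) \<and> (\<forall>c. \<forall>x\<in>V. c \<cdot>\<^sub>m x \<in> V)"

inductive_set mspan :: "nat \<Rightarrow> complex mat set \<Rightarrow> complex mat set"
  for N :: nat and A :: "complex mat set" where
  zero: "0\<^sub>m N N \<in> mspan N A"
| gen: "a \<in> A \<Longrightarrow> a \<in> mspan N A"
| add: "x \<in> mspan N A \<Longrightarrow> y \<in> mspan N A \<Longrightarrow> x + y \<in> mspan N A"
| smult: "x \<in> mspan N A \<Longrightarrow> c \<cdot>\<^sub>m x \<in> mspan N A"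

definition hessA :: "nat \<Rightarrow> complex mat set \<Rightarrow> bool" where
  "hessA n H \<longleftrightarrow> is_msubspace (2*n) H \<and> H \<subseteq> sl n \<and>
     (\<forall>b\<in>bor n. \<forall>y\<in>H. bracket b y \<in> H)"

definition hessC :: "nat \<Rightarrow> complex mat set \<Rightarrow> bool" where
  "hessC n HC \<longleftrightarrow> is_msubspace (2*n) HC \<and> HC \<subseteq> gC n \<and>
     (\<forall>b\<in>bC n. \<forall>y\<in>HC. bracket b y \<in> HC)"

definition unitE :: "nat \<Rightarrow> nat \<Rightarrow> nat \<Rightarrow> complex mat" where
  "unitE N i j = mat N N (\<lambda>(a,b). if a = i \<and> b = j then 1 else 0)"

definition rootspace :: "nat \<Rightarrow> nat \<Rightarrow> nat \<Rightarrow> complex mat set" where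
  "rootspace n i j = {x \<in> gC n. \<forall>h\<in>hsig n.
      bracket h x = (h $$ (i,i) - h $$ (j,j)) \<cdot>\<^sub>m x}"

(* Phi_H, as the set of index pairs (i,j) standing for eps_i - eps_j *)
definition PhiH :: "nat \<Rightarrow> complex mat set \<Rightarrow> (nat \<times> nat) set" where
  "PhiH n HC = {(i,j). i < 2*n \<and> j < 2*n \<and> i \<noteq> j \<and> rootspace n i j \<subseteq> HC}"

definition Hcart :: "nat \<Rightarrow> complex mat set \<Rightarrow> complex mat set" where
  "Hcart n HC = mspan (2*n) ((HC \<inter> hsig n) \<union>
     {unitE (2*n) i i - unitE (2*n) j j | i j. (i,j) \<in> PhiH n HC \<and> (j,i) \<in> PhiH n HC})"

definition HfromC :: "nat \<Rightarrow> complex mat set \<Rightarrow> complex mat set" where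
  "HfromC n HC = {h + e | h e. h \<in> Hcart n HC \<and>
      e \<in> mspan (2*n) {unitE (2*n) i j | i j. (i,j) \<in> PhiH n HC}}"

definition cosetA :: "nat \<Rightarrow> complex mat \<Rightarrow> complex mat set" where
  "cosetA n g = {g * b | b. b \<in> Bor n}"

definition cosetC :: "nat \<Rightarrow> complex mat \<Rightarrow> complex mat set" where
  "cosetC n g = {g * b | b. b \<in> BC n}"

definition flagA :: "nat \<Rightarrow> complex mat set set" where
  "flagA n = cosetA n ` SL n"

definition flagC :: "nat \<Rightarrow> complex mat set set" where
  "flagC n = cosetC n ` GC n"

definition sigma_flag :: "nat \<Rightarrow> complex mat set \<Rightarrow> complex mat set" where
  "sigma_flag n F = cosetA n (sigma_grp n (SOME g. g \<in> SL n \<and> F = cosetA n g))"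

definition phi' :: "nat \<Rightarrow> complex mat set \<Rightarrow> complex mat set" where
  "phi' n F = cosetA n (SOME g. g \<in> GC n \<and> F = cosetC n g)"

definition HessA :: "nat \<Rightarrow> complex mat \<Rightarrow> complex mat set \<Rightarrow> complex mat set set" where
  "HessA n x H = {cosetA n g | g. g \<in> SL n \<and> minv g * x * g \<in> H}"

definition HessC :: "nat \<Rightarrow> complex mat \<Rightarrow> complex mat set \<Rightarrow> complex mat set set" where
  "HessC n x HC = {cosetC n g | g. g \<in> GC n \<and> minv g * x * g \<in> HC}"

end

theory Submission
  imports Defs
begin

text \<open>
  Since \<open>HC\<close> is stable under the diagonal matrices of \<open>\<bb>\<^sub>C\<close>, it is a sum of weight spaces, and all
  nonzero weight spaces are lines spanned by \<open>E\<^sub>i\<^sub>j + \<sigma>(E\<^sub>i\<^sub>j)\<close>. Hence \<open>(i,j) \<in> \<Phi>\<^sub>H\<close> iff some element of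
  \<open>HC\<close> has a nonzero \<open>(i,j)\<close> entry, and stability of \<open>H\<close> under \<open>\<bb>\<close> reduces to closure properties
  of \<open>\<Phi>\<^sub>H\<close> that are read off from entries of brackets. Symmetrizing \<open>y \<mapsto> y + \<sigma>(y)\<close> maps \<open>H\<close> into
  \<open>HC\<close>, so \<open>H\<^sup>\<sigma> = HC\<close>.

  For the flags, let \<open>gB\<close> be \<open>\<sigma>\<close>-fixed, so \<open>\<sigma>(g) = g b\<close> with \<open>b \<in> B\<close>. Then \<open>E b\<^sup>T = b E\<close>, and this
  relation is inherited by a square root \<open>c\<close> of \<open>b\<close> that is a polynomial in \<open>b\<close>. It follows that
  \<open>g c\<close> preserves the symplectic form; it has determinant one by the transformation law of the
  Pfaffian. Conjugation by \<open>c\<close> preserves \<open>H\<close>, and \<open>(g c)\<^sup>-\<^sup>1 x (g c)\<close> is \<open>\<sigma>\<close>-fixed, hence in \<open>HC\<close>.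
\<close>

section \<open>The involution and matrix subspaces\<close>

text \<open>\<open>HC\<close> is closed under brackets with \<open>bC\<close> only and is in general
  no subalgebra. A pair in \<open>PhiH\<close> can therefore be moved only by positive roots, that
  is, up or to the right in the matrix. The bracket of E_kl with E_lk is E_kk - E_ll, so the Cartan
  part of H has to contain such differences. A root of type C belongs to the two pairs (i,j) and
  (j',i'), which coincide for a long root, where j = i'. These overlaps produce factors 2 in
  brackets of root vectors; the signs ensure that nothing cancels.

  For the flags, the correction c has to satisfy c E c^T = b E. If E c^T = c E, this says c c = b. A
  square root that is a polynomial in b inherits this relation and the triangular shape from b,
  which is not automatic for other square roots. Determinants of (g c) E (g c)^T = E yield only det
  (g c) = 1 or -1, hence the Pfaffian. It is expanded over all permutations and not over perfect
  matchings, because exchanging the sums then produces determinants.\<close>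

definition mirror :: "nat \<Rightarrow> nat \<Rightarrow> nat" where "mirror n i = 2*n - 1 - i"

text \<open>The only nonzero entry in row \<open>i\<close> of \<open>Emat n\<close> is
  \<open>esign n i\<close>, in column \<open>mirror n i\<close>, the index written i' in the
  statement.\<close>

definition esign :: "nat \<Rightarrow> nat \<Rightarrow> complex" where "esign n i = (if i < n then 1 else -1)"

lemma mirror_less [simp]: "i < 2*n \<Longrightarrow> mirror n i < 2*n"
  and mirror_mirror [simp]: "i < 2*n \<Longrightarrow> mirror n (mirror n i) = i"
  and mirror_neq [simp]: "mirror n i \<noteq> i" "i \<noteq> mirror n i" if "i < 2*n"
  using that by (auto simp: mirror_def) presburger+

lemma mirror_eq_iff [simp]: "i < 2*n \<Longrightarrow> j < 2*n \<Longrightarrow> mirror n i = mirror n j \<longleftrightarrow> i = j"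
  by (auto simp: mirror_def)

lemma mirror_swap: "i < 2*n \<Longrightarrow> j < 2*n \<Longrightarrow> mirror n i = j \<longleftrightarrow> i = mirror n j"
  by (auto simp: mirror_def)

lemma mirror_less_iff [simp]: "i < 2*n \<Longrightarrow> j < 2*n \<Longrightarrow> mirror n i < mirror n j \<longleftrightarrow> j < i"
  by (auto simp: mirror_def)

lemma esign_mirror [simp]: "i < 2*n \<Longrightarrow> esign n (mirror n i) = - esign n i"
  by (auto simp: mirror_def esign_def)

lemma esign_sq [simp]: "esign n i * esign n i = 1" "esign n i * (esign n i * x) = x"
  by (auto simp: esign_def)

lemma esign_nz [simp]: "esign n i \<noteq> 0"
  by (auto simp: esign_def)

lemma Emat_index: "i < 2*n \<Longrightarrow> j < 2*n \<Longrightarrow> Emat n $$ (i,j) = (if j = mirror n i then esign n i else 0)"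
  by (auto simp: Emat_def Jmat_def mirror_def esign_def)

lemma Emat_carrier [simp]: "Emat n \<in> carrier_mat (2*n) (2*n)"
  by (simp add: Emat_def)

lemma Emat_dim [simp]: "dim_row (Emat n) = 2*n" "dim_col (Emat n) = 2*n"
  by (simp_all add: Emat_def)

lemma index_mult_sum:
  "i < dim_row A \<Longrightarrow> j < dim_col B \<Longrightarrow> dim_col A = dim_row B \<Longrightarrow>
    (A * B) $$ (i,j) = (\<Sum>k<dim_row B. A $$ (i,k) * B $$ (k,j))"
  by (auto simp: scalar_prod_def intro!: sum.cong)

lemma sum_eq_single:
  fixes g :: "nat \<Rightarrow> 'a :: comm_monoid_add"
  assumes "l < N" "\<And>m. m < N \<Longrightarrow> m \<noteq> l \<Longrightarrow> g m = 0"
  shows "(\<Sum>m<N. g m) = g l"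
  using assms by (subst sum.remove[of _ l]) (auto intro!: sum.neutral)

lemma Emat_mult_left:
  assumes "x \<in> carrier_mat (2*n) m" "i < 2*n" "j < m"
  shows "(Emat n * x) $$ (i,j) = esign n i * x $$ (mirror n i, j)"
proof -
  have "(Emat n * x) $$ (i,j) = (\<Sum>k<2*n. Emat n $$ (i,k) * x $$ (k,j))"
    using assms by (subst index_mult_sum) auto
  also have "\<dots> = Emat n $$ (i,mirror n i) * x $$ (mirror n i,j)"
    using assms by (intro sum_eq_single) (auto simp: Emat_index)
  finally show ?thesis using assms by (simp add: Emat_index)
qed

text \<open>The nonzero entry of column \<open>j\<close> lies in row \<open>mirror n j\<close>,
  whose sign is opposite to that of \<open>j\<close>; hence the minus.\<close>

lemma Emat_mult_right:
  assumes "x \<in> carrier_mat m (2*n)" "i < m" "j < 2*n"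
  shows "(x * Emat n) $$ (i,j) = - esign n j * x $$ (i, mirror n j)"
proof -
  have "(x * Emat n) $$ (i,j) = (\<Sum>k<2*n. x $$ (i,k) * Emat n $$ (k,j))"
    using assms by (subst index_mult_sum) auto
  also have "\<dots> = x $$ (i,mirror n j) * Emat n $$ (mirror n j,j)"
    using assms by (intro sum_eq_single) (auto simp: Emat_index)
  finally show ?thesis using assms by (simp add: Emat_index)
qed

lemma sigma_alg_carrier [simp]: "sigma_alg n x \<in> carrier_mat (2*n) (2*n)"
  unfolding sigma_alg_def by (rule carrier_matI) simp_all

lemma sigma_alg_dim [simp]: "dim_row (sigma_alg n x) = 2*n" "dim_col (sigma_alg n x) = 2*n"
  by (simp_all add: sigma_alg_def)

text \<open>Up to signs, sigma is the reflection in the antidiagonal. Most later arguments about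
  \<open>sigma_alg\<close> use this entrywise form.\<close>

lemma sigma_alg_index:
  assumes "x \<in> carrier_mat (2*n) (2*n)" "i < 2*n" "j < 2*n"
  shows "sigma_alg n x $$ (i,j) = - esign n i * esign n j * x $$ (mirror n j, mirror n i)"
proof -
  have "sigma_alg n x $$ (i,j) = - esign n j * (Emat n * transpose_mat x) $$ (i, mirror n j)"
    unfolding sigma_alg_def using assms by (intro Emat_mult_right) (auto simp: mult_carrier_mat[of _ "2*n" "2*n"])
  also have "(Emat n * transpose_mat x) $$ (i, mirror n j) = esign n i * transpose_mat x $$ (mirror n i, mirror n j)"
    using assms by (intro Emat_mult_left) auto
  finally show ?thesis using assms by simp
qed

section \<open>Subspaces and spans of matrices\<close>

lemma
  assumes "is_msubspace N V"
  shows msubspace_carrier: "x \<in> V \<Longrightarrow> x \<in> carrier_mat N N"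
    and msubspace_zero: "0\<^sub>m N N \<in> V"
    and msubspace_add: "x \<in> V \<Longrightarrow> y \<in> V \<Longrightarrow> x + y \<in> V"
    and msubspace_smult: "x \<in> V \<Longrightarrow> c \<cdot>\<^sub>m x \<in> V"
  using assms unfolding is_msubspace_def by auto

lemma msubspace_minus:
  assumes "is_msubspace N V" "x \<in> V" "y \<in> V"
  shows "x - y \<in> V"
proof -
  have "x - y = x + (-1) \<cdot>\<^sub>m y"
    using msubspace_carrier[OF assms(1)] assms(2,3) by (intro eq_matI) auto
  then show ?thesis using assms by (simp add: msubspace_add msubspace_smult)
qed

lemma mspan_carrier: "A \<subseteq> carrier_mat N N \<Longrightarrow> mspan N A \<subseteq> carrier_mat N N"
proof
  fix x assume "x \<in> mspan N A" "A \<subseteq> carrier_mat N N"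
  then show "x \<in> carrier_mat N N" by (induction) auto
qed

lemma is_msubspace_mspan: "A \<subseteq> carrier_mat N N \<Longrightarrow> is_msubspace N (mspan N A)"
  using mspan_carrier by (auto simp: is_msubspace_def intro: mspan.intros)

lemma mspan_least:
  assumes "is_msubspace N V" "A \<subseteq> V"
  shows "mspan N A \<subseteq> V"
proof
  fix x assume "x \<in> mspan N A"
  then show "x \<in> V" using assms
    by induction (auto intro: msubspace_zero msubspace_add msubspace_smult)
qed

lemma mspan_mono: "A \<subseteq> B \<Longrightarrow> x \<in> mspan N A \<Longrightarrow> x \<in> mspan N B"
  by (rotate_tac, induction rule: mspan.induct) (auto intro: mspan.intros)

text \<open>Turns \<open>HfromC\<close>, a sum of two spans, into a single span, so that inclusions
  can be tested on generators.\<close>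

lemma mspan_Un:
  assumes "A \<subseteq> carrier_mat N N" "B \<subseteq> carrier_mat N N"
  shows "mspan N (A \<union> B) = {a + b | a b. a \<in> mspan N A \<and> b \<in> mspan N B}" (is "?L = ?R")
proof
  note A = mspan_carrier[OF assms(1)] and B = mspan_carrier[OF assms(2)]
  show "?R \<subseteq> ?L" by (auto intro!: mspan.add intro: mspan_mono)
  have "is_msubspace N ?R" unfolding is_msubspace_def
  proof (intro conjI ballI allI)
    show "?R \<subseteq> carrier_mat N N" using A B by auto
    show "0\<^sub>m N N \<in> ?R" by (intro CollectI exI[of _ "0\<^sub>m N N"]) (auto intro: mspan.zero)
  next
    fix x y assume "x \<in> ?R" "y \<in> ?R"
    then obtain a b c d where *: "x = a + b" "y = c + d" "a \<in> mspan N A" "b \<in> mspan N B"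
      "c \<in> mspan N A" "d \<in> mspan N B" by auto
    moreover have "a \<in> carrier_mat N N" "b \<in> carrier_mat N N" "c \<in> carrier_mat N N" "d \<in> carrier_mat N N"
      using * A B by auto
    ultimately have "x + y = (a + c) + (b + d)" by (intro eq_matI) auto
    then show "x + y \<in> ?R" using * by (blast intro: mspan.add)
  next
    fix r x assume "x \<in> ?R"
    then obtain a b where *: "x = a + b" "a \<in> mspan N A" "b \<in> mspan N B" by auto
    moreover have "a \<in> carrier_mat N N" "b \<in> carrier_mat N N" using * A B by auto
    ultimately have "r \<cdot>\<^sub>m x = r \<cdot>\<^sub>m a + r \<cdot>\<^sub>m b" by (intro eq_matI) (auto simp: distrib_left)
    then show "r \<cdot>\<^sub>m x \<in> ?R" using * by (blast intro: mspan.smult)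
  qed
  moreover have "A \<union> B \<subseteq> ?R"
  proof
    fix x assume "x \<in> A \<union> B"
    then show "x \<in> ?R"
    proof
      assume "x \<in> A"
      then show ?thesis using assms
        by (intro CollectI exI[of _ x] exI[of _ "0\<^sub>m N N"]) (auto intro: mspan.intros)
    next
      assume "x \<in> B"
      then show ?thesis using assms
        by (intro CollectI exI[of _ "0\<^sub>m N N"] exI[of _ x]) (auto intro: mspan.intros)
    qed
  qed
  ultimately show "?L \<subseteq> ?R" by (rule mspan_least)
qed

lemma unitE_carrier [simp]: "unitE N i j \<in> carrier_mat N N"
  and unitE_dim [simp]: "dim_row (unitE N i j) = N" "dim_col (unitE N i j) = N"
  and unitE_index [simp]: "a < N \<Longrightarrow> b < N \<Longrightarrow> unitE N i j $$ (a,b) = (if a = i \<and> b = j then 1 else 0)"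
  by (simp_all add: unitE_def)

text \<open>Induction on the set of positions at which the entries of \<open>x\<close> are kept.
  Asking only for the units at nonzero entries suits triangular matrices and elements of
  \<open>HC\<close>.\<close>

lemma mat_in_msubspaceI:
  assumes V: "is_msubspace N V" and x: "x \<in> carrier_mat N N"
    and E: "\<And>a b. a < N \<Longrightarrow> b < N \<Longrightarrow> x $$ (a,b) \<noteq> 0 \<Longrightarrow> unitE N a b \<in> V"
  shows "x \<in> V"
proof -
  have *: "mat N N (\<lambda>p. if p \<in> S then x $$ p else 0) \<in> V" if "finite S" "S \<subseteq> {..<N} \<times> {..<N}" for S
    using that
  proof (induction S rule: finite_induct)
    case empty
    have "mat N N (\<lambda>p. if p \<in> {} then x $$ p else 0) = 0\<^sub>m N N" by (intro eq_matI) auto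
    then show ?case using V by (simp add: msubspace_zero)
  next
    case (insert p S)
    obtain a b where p: "p = (a,b)" by fastforce
    have ab: "a < N" "b < N" using insert.prems p by auto
    have eq: "mat N N (\<lambda>q. if q \<in> insert p S then x $$ q else 0)
        = mat N N (\<lambda>q. if q \<in> S then x $$ q else 0) + x $$ (a,b) \<cdot>\<^sub>m unitE N a b"
      using insert.hyps p by (intro eq_matI) auto
    have "x $$ (a,b) \<cdot>\<^sub>m unitE N a b \<in> V"
    proof (cases "x $$ (a,b) = 0")
      case True
      then have "x $$ (a,b) \<cdot>\<^sub>m unitE N a b = 0\<^sub>m N N" by (intro eq_matI) auto
      then show ?thesis using V by (simp add: msubspace_zero)
    qed (use ab E V in \<open>auto intro: msubspace_smult\<close>)
    then show ?case unfolding eq using insert V by (auto intro: msubspace_add)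
  qed
  have "mat N N (\<lambda>p. if p \<in> {..<N} \<times> {..<N} then x $$ p else 0) = x"
    using x by (intro eq_matI) auto
  then show ?thesis using *[of "{..<N} \<times> {..<N}"] by simp
qed

section \<open>Brackets, and diagonal matrices acting by weights\<close>

lemma bracket_carrier [simp]:
  "x \<in> carrier_mat N N \<Longrightarrow> y \<in> carrier_mat N N \<Longrightarrow> bracket x y \<in> carrier_mat N N"
  unfolding bracket_def by (rule carrier_matI) simp_all

lemma bracket_dim:
  "x \<in> carrier_mat N N \<Longrightarrow> y \<in> carrier_mat N N \<Longrightarrow> dim_row (bracket x y) = N"
  "x \<in> carrier_mat N N \<Longrightarrow> y \<in> carrier_mat N N \<Longrightarrow> dim_col (bracket x y) = N"
  by (simp_all add: bracket_def)

lemma bracket_index: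
  assumes "x \<in> carrier_mat N N" "y \<in> carrier_mat N N" "a < N" "b < N"
  shows "bracket x y $$ (a,b) = (\<Sum>k<N. x $$ (a,k) * y $$ (k,b)) - (\<Sum>k<N. y $$ (a,k) * x $$ (k,b))"
  using assms unfolding bracket_def
  by (subst index_minus_mat) (auto simp: index_mult_sum simp del: index_mult_mat(1))

lemma bracket_linear:
  assumes "a \<in> carrier_mat N N" "b \<in> carrier_mat N N" "y \<in> carrier_mat N N"
  shows bracket_add_left: "bracket (a + b) y = bracket a y + bracket b y"
    and bracket_add_right: "bracket y (a + b) = bracket y a + bracket y b"
    and bracket_smult_left: "bracket (c \<cdot>\<^sub>m a) y = c \<cdot>\<^sub>m bracket a y"
    and bracket_smult_right: "bracket y (c \<cdot>\<^sub>m a) = c \<cdot>\<^sub>m bracket y a"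
  using assms unfolding bracket_def
  by (auto intro!: eq_matI simp: add_mult_distrib_mat[of _ N N] mult_add_distrib_mat[of _ N N]
      mult_smult_distrib[of _ N N] mult_smult_assoc_mat[of _ N N] algebra_simps
      simp del: index_mult_mat(1))

text \<open>With \<open>mspan_least\<close>, this reduces a bracket condition on a span to its
  generators, in either argument.\<close>

lemma is_msubspace_bracket:
  assumes V: "is_msubspace N V" and y: "y \<in> carrier_mat N N"
  shows "is_msubspace N {b \<in> carrier_mat N N. bracket b y \<in> V}"
    "is_msubspace N {b \<in> carrier_mat N N. bracket y b \<in> V}"
proof -
  have "bracket (0\<^sub>m N N) y = 0\<^sub>m N N" "bracket y (0\<^sub>m N N) = 0\<^sub>m N N"
    using y by (auto simp: bracket_def)
  then show "is_msubspace N {b \<in> carrier_mat N N. bracket b y \<in> V}"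
    "is_msubspace N {b \<in> carrier_mat N N. bracket y b \<in> V}"
    using V y by (auto simp: is_msubspace_def bracket_linear[where N=N])
qed

lemma bracket_unitE_index:
  assumes "x \<in> carrier_mat N N" "k < N" "l < N" "a < N" "b < N"
  shows "bracket (unitE N k l) x $$ (a,b) =
    (if a = k then x $$ (l,b) else 0) - (if b = l then x $$ (a,k) else 0)"
proof -
  have "(\<Sum>m<N. unitE N k l $$ (a,m) * x $$ (m,b)) = unitE N k l $$ (a,l) * x $$ (l,b)"
    using assms by (intro sum_eq_single) auto
  moreover have "(\<Sum>m<N. x $$ (a,m) * unitE N k l $$ (m,b)) = x $$ (a,k) * unitE N k l $$ (k,b)"
    using assms by (intro sum_eq_single) auto
  ultimately show ?thesis using assms by (simp add: bracket_index[where N=N])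
qed

definition diag_fun :: "nat \<Rightarrow> (nat \<Rightarrow> complex) \<Rightarrow> complex mat" where
  "diag_fun N f = mat N N (\<lambda>(a,b). if a = b then f a else 0)"

lemma diag_fun_carrier [simp]: "diag_fun N f \<in> carrier_mat N N"
  and diag_fun_dim [simp]: "dim_row (diag_fun N f) = N" "dim_col (diag_fun N f) = N"
  and diag_fun_index [simp]: "a < N \<Longrightarrow> b < N \<Longrightarrow> diag_fun N f $$ (a,b) = (if a = b then f a else 0)"
  by (simp_all add: diag_fun_def)

lemma bracket_diag_fun_index:
  assumes "x \<in> carrier_mat N N" "a < N" "b < N"
  shows "bracket (diag_fun N f) x $$ (a,b) = (f a - f b) * x $$ (a,b)"
proof -
  have "(\<Sum>m<N. diag_fun N f $$ (a,m) * x $$ (m,b)) = diag_fun N f $$ (a,a) * x $$ (a,b)"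
    using assms by (intro sum_eq_single) auto
  moreover have "(\<Sum>m<N. x $$ (a,m) * diag_fun N f $$ (m,b)) = x $$ (a,b) * diag_fun N f $$ (b,b)"
    using assms by (intro sum_eq_single) auto
  ultimately show ?thesis using assms by (simp add: bracket_index[where N=N] algebra_simps)
qed

lemma hsig_mirror:
  assumes "h \<in> hsig n" "a < 2*n"
  shows "h $$ (mirror n a, mirror n a) = - h $$ (a,a)"
proof -
  have "h $$ (a,a) = - h $$ (mirror n a, mirror n a)"
    using assms unfolding hsig_def mirror_def by blast
  then show ?thesis by simp
qed

lemma diag_fun_in_hsig:
  assumes "\<And>a. a < 2*n \<Longrightarrow> f (mirror n a) = - f a"
  shows "diag_fun (2*n) f \<in> hsig n"
proof -
  have "diag_fun (2*n) f $$ (a,a) = - diag_fun (2*n) f $$ (2*n-1-a, 2*n-1-a)" if "a < 2*n" for a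
    using assms[OF that] that unfolding mirror_def by simp
  moreover have "diagonal_mat (diag_fun (2*n) f)" by (simp add: diagonal_mat_def)
  ultimately show ?thesis unfolding hsig_def using diag_fun_carrier by blast
qed

lemma hsig_carrier: "h \<in> hsig n \<Longrightarrow> h \<in> carrier_mat (2*n) (2*n)"
  unfolding hsig_def by blast

lemma hsig_offdiag: "h \<in> hsig n \<Longrightarrow> a < 2*n \<Longrightarrow> b < 2*n \<Longrightarrow> a \<noteq> b \<Longrightarrow> h $$ (a,b) = 0"
  using carrier_matD[OF hsig_carrier[of h n]] unfolding hsig_def diagonal_mat_def mem_Collect_eq by metis

lemma hsig_eq_diag_fun: "h \<in> hsig n \<Longrightarrow> h = diag_fun (2*n) (\<lambda>a. h $$ (a,a))"
  using hsig_offdiag[of h n] carrier_matD[OF hsig_carrier[of h n]] by (intro eq_matI) auto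

lemma mtrace_sum: "x \<in> carrier_mat N N \<Longrightarrow> mtrace x = (\<Sum>i<N. x $$ (i,i))"
  by (simp add: mtrace_def)

lemma sum_mirror: "(\<Sum>i<2*n. f (mirror n i)) = (\<Sum>i<2*n. f i)"
  by (rule sum.reindex_bij_witness[of _ "mirror n" "mirror n"]) simp_all

text \<open>At a diagonal position the hypothesis reads x_aa = -x_a'a', so the diagonal cancels in
  mirrored pairs and the trace is zero.\<close>

lemma gC_I:
  assumes "x \<in> carrier_mat (2*n) (2*n)"
    and "\<And>a b. a < 2*n \<Longrightarrow> b < 2*n \<Longrightarrow> x $$ (a,b) = - esign n a * esign n b * x $$ (mirror n b, mirror n a)"
  shows "x \<in> gC n"
proof -
  have *: "x $$ (a,a) = - x $$ (mirror n a, mirror n a)" if "a < 2*n" for a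
    using assms(2)[OF that that] by (simp (no_asm_use))
  have "(\<Sum>i<2*n. x $$ (i,i)) = - (\<Sum>i<2*n. x $$ (mirror n i, mirror n i))"
    unfolding sum_negf[symmetric] using * by (intro sum.cong) blast+
  then have "mtrace x = 0" using sum_mirror[of "\<lambda>i. x $$ (i,i)" n] assms(1) by (simp add: mtrace_sum)
  moreover have "sigma_alg n x = x"
    by (intro eq_matI) (simp_all only: sigma_alg_index[OF assms(1)] sigma_alg_dim carrier_matD[OF assms(1)]
        assms(2)[symmetric])
  ultimately show ?thesis using assms by (auto simp: gC_def sl_def)
qed

lemma gC_carrier: "x \<in> gC n \<Longrightarrow> x \<in> carrier_mat (2*n) (2*n)"
  by (simp add: gC_def sl_def)

lemma gC_index:
  assumes "x \<in> gC n" "a < 2*n" "b < 2*n"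
  shows "x $$ (mirror n b, mirror n a) = - esign n a * esign n b * x $$ (a,b)"
proof -
  have "x $$ (mirror n b, mirror n a) = sigma_alg n x $$ (mirror n b, mirror n a)"
    using assms(1) by (simp add: gC_def)
  also have "\<dots> = - esign n a * esign n b * x $$ (a,b)"
    using assms(2,3) by (subst sigma_alg_index[OF gC_carrier[OF assms(1)]]) simp_all
  finally show ?thesis .
qed

lemma hsig_sub_gC: "h \<in> hsig n \<Longrightarrow> h \<in> gC n"
proof (rule gC_I)
  assume h: "h \<in> hsig n"
  show "h \<in> carrier_mat (2*n) (2*n)" using h by (rule hsig_carrier)
  fix a b assume "a < 2*n" "b < 2*n"
  then show "h $$ (a,b) = - esign n a * esign n b * h $$ (mirror n b, mirror n a)"
    using hsig_mirror[OF h, of a] hsig_offdiag[OF h, of a b] hsig_offdiag[OF h, of "mirror n b" "mirror n a"]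
    by (cases "a = b") auto
qed

section \<open>Root vectors of the symplectic Lie algebra\<close>

text \<open>For a long root, \<open>j = mirror n i\<close>, the two summands coincide and this is 2
  E_ij.\<close>

definition root_vec :: "nat \<Rightarrow> nat \<Rightarrow> nat \<Rightarrow> complex mat" where
  "root_vec n i j = unitE (2*n) i j + sigma_alg n (unitE (2*n) i j)"

lemma root_vec_carrier [simp]: "root_vec n i j \<in> carrier_mat (2*n) (2*n)"
  and root_vec_dim [simp]: "dim_row (root_vec n i j) = 2*n" "dim_col (root_vec n i j) = 2*n"
  by (simp_all add: root_vec_def)

lemma sigma_unitE: 
  assumes "i < 2*n" "j < 2*n" 
  shows "sigma_alg n (unitE (2*n) i j) = (- esign n i * esign n j) \<cdot>\<^sub>m unitE (2*n) (mirror n j) (mirror n i)"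
proof (rule eq_matI)
  fix a b assume "a < dim_row ((- esign n i * esign n j) \<cdot>\<^sub>m unitE (2*n) (mirror n j) (mirror n i))"
    "b < dim_col ((- esign n i * esign n j) \<cdot>\<^sub>m unitE (2*n) (mirror n j) (mirror n i))"
  then have ab: "a < 2*n" "b < 2*n" by simp_all
  have "(mirror n b = i \<and> mirror n a = j) = (a = mirror n j \<and> b = mirror n i)"
    using mirror_swap[OF ab(2) assms(1)] mirror_swap[OF ab(1) assms(2)] by blast
  then show "sigma_alg n (unitE (2*n) i j) $$ (a,b)
      = ((- esign n i * esign n j) \<cdot>\<^sub>m unitE (2*n) (mirror n j) (mirror n i)) $$ (a,b)"
    using ab assms by (auto simp: sigma_alg_index)
qed simp_all

lemma root_vec_index:
  assumes "i < 2*n" "j < 2*n" "a < 2*n" "b < 2*n"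
  shows "root_vec n i j $$ (a,b) = (if a = i \<and> b = j then 1 else 0)
     - esign n i * esign n j * (if a = mirror n j \<and> b = mirror n i then 1 else 0)"
  using assms by (simp add: root_vec_def sigma_unitE)

lemma root_vec_gC: "i < 2*n \<Longrightarrow> j < 2*n \<Longrightarrow> root_vec n i j \<in> gC n"
proof (rule gC_I)
  fix a b assume ij: "i < 2*n" "j < 2*n" and ab: "a < 2*n" "b < 2*n"
  have "(mirror n b = i \<and> mirror n a = j) = (a = mirror n j \<and> b = mirror n i)"
    using mirror_swap[OF ab(2) ij(1)] mirror_swap[OF ab(1) ij(2)] by blast
  moreover have "(mirror n b = mirror n j \<and> mirror n a = mirror n i) = (a = i \<and> b = j)" using ij ab by auto
  ultimately have r: "root_vec n i j $$ (mirror n b, mirror n a) = (if a = mirror n j \<and> b = mirror n i then 1 else 0)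
      - esign n i * esign n j * (if a = i \<and> b = j then 1 else 0)"
    using ij ab by (simp add: root_vec_index)
  \<comment> \<open>\<open>P\<close> and \<open>Q\<close> say which of the two support positions
    (a,b) is; both hold at once for a long root. \<open>s\<close> and \<open>t\<close> are the sign
    products at (i,j) and at (a,b).\<close>
  have key: "(if P then 1 else 0) - s * (if Q then 1 else 0)
      = - t * ((if Q then 1 else 0) - s * (if P then 1 else 0))"
    if "P \<or> Q \<Longrightarrow> t = s" "s * s = 1" for P Q and s t :: complex
    using that by (cases P; cases Q) (simp_all add: algebra_simps)
  have t: "esign n a * esign n b = esign n i * esign n j" if "a = i \<and> b = j \<or> a = mirror n j \<and> b = mirror n i"
    using that
  proof
    assume "a = mirror n j \<and> b = mirror n i"
    then show ?thesis using ij by simp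
  qed simp
  have "(esign n i * esign n j) * (esign n i * esign n j) = 1" by (simp add: esign_def)
  from key[OF t this] show "root_vec n i j $$ (a,b) = - esign n a * esign n b * root_vec n i j $$ (mirror n b, mirror n a)"
    unfolding root_vec_index[OF ij ab] r mult_minus_left .
qed simp

text \<open>Mirroring reverses the order and the pair is also swapped, so the second support
  position is above the diagonal as well.\<close>

lemma root_vec_bC:
  assumes "i < j" "j < 2*n"
  shows "root_vec n i j \<in> bC n"
proof -
  have "root_vec n i j $$ (a,b) = 0" if "b < a" "a < 2*n" for a b
  proof -
    have "\<not> (a = i \<and> b = j)" using that assms by auto
    moreover have "\<not> (a = mirror n j \<and> b = mirror n i)" using that assms mirror_less_iff[of j n i] by auto
    ultimately show ?thesis using that assms by (auto simp: root_vec_index)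
  qed
  then have "upper_triangular (root_vec n i j)" by (simp add: upper_triangular_def)
  then show ?thesis using root_vec_gC[of i n j] assms by (simp add: bC_def bor_def gC_def)
qed

lemma hsig_bC: "h \<in> hsig n \<Longrightarrow> h \<in> bC n"
proof -
  assume h: "h \<in> hsig n"
  then have "upper_triangular h"
    using hsig_offdiag[OF h] carrier_matD[OF hsig_carrier[OF h]] by (auto simp: upper_triangular_def)
  then show ?thesis using hsig_sub_gC[OF h] by (simp add: bC_def bor_def gC_def)
qed

lemma bracket_root_vec_index:
  assumes "x \<in> carrier_mat (2*n) (2*n)" "k < 2*n" "l < 2*n" "a < 2*n" "b < 2*n"
  shows "bracket (root_vec n k l) x $$ (a,b) =
    (if a = k then x $$ (l,b) else 0) - (if b = l then x $$ (a,k) else 0)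
    - esign n k * esign n l * ((if a = mirror n l then x $$ (mirror n k,b) else 0) - (if b = mirror n k then x $$ (a,mirror n l) else 0))"
proof -
  let ?N = "2*n"
  have "bracket (root_vec n k l) x = bracket (unitE ?N k l) x + (- esign n k * esign n l) \<cdot>\<^sub>m bracket (unitE ?N (mirror n l) (mirror n k)) x"
    using assms unfolding root_vec_def sigma_unitE[OF assms(2,3)] by (simp add: bracket_linear[where N="2*n"])
  then show ?thesis using assms by (simp add: bracket_unitE_index bracket_dim[where N="2*n"])
qed


text \<open>The entry is 1, or 2 for a long root: there the signs of \<open>i\<close> and
  \<open>j\<close> are opposite, so the two contributions add.\<close>

lemma root_vec_self:
  assumes "i < 2*n" "j < 2*n"
  shows "root_vec n i j $$ (i,j) \<noteq> 0"
proof (cases "i = mirror n j \<and> j = mirror n i")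
  case True
  then have "esign n j = - esign n i" using esign_mirror[OF assms(1)] by metis
  moreover have "root_vec n i j $$ (i,j) = 1 - esign n i * esign n j"
    unfolding root_vec_index[OF assms assms] if_P[OF True] by simp
  ultimately show ?thesis by simp
next
  case False
  show ?thesis unfolding root_vec_index[OF assms assms] if_not_P[OF False] by simp
qed

lemma root_vec_other:
  "i < 2*n \<Longrightarrow> j < 2*n \<Longrightarrow> root_vec n i j $$ (mirror n j, mirror n i) = - esign n i * esign n j * root_vec n i j $$ (i,j)"
  by (rule gC_index[OF root_vec_gC])

lemma root_vec_zero:
  "i < 2*n \<Longrightarrow> j < 2*n \<Longrightarrow> a < 2*n \<Longrightarrow> b < 2*n \<Longrightarrow>
    \<not> (a = i \<and> b = j) \<Longrightarrow> \<not> (a = mirror n j \<and> b = mirror n i) \<Longrightarrow> root_vec n i j $$ (a,b) = 0"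
  by (simp only: root_vec_index if_False) simp

text \<open>Root spaces are lines: the symmetry \<open>gC_index\<close> determines the entry at the
  mirrored position. Dividing by the entry of \<open>root_vec\<close> treats short and long roots
  alike.\<close>

lemma gC_eq_root_vec:
  assumes x: "x \<in> gC n" and ij: "i < 2*n" "j < 2*n"
    and z: "\<And>a b. a < 2*n \<Longrightarrow> b < 2*n \<Longrightarrow> \<not> (a = i \<and> b = j) \<Longrightarrow> \<not> (a = mirror n j \<and> b = mirror n i) \<Longrightarrow> x $$ (a,b) = 0"
  shows "x = (x $$ (i,j) / root_vec n i j $$ (i,j)) \<cdot>\<^sub>m root_vec n i j"
proof (rule eq_matI)
  let ?c = "x $$ (i,j) / root_vec n i j $$ (i,j)"
  fix a b assume "a < dim_row (?c \<cdot>\<^sub>m root_vec n i j)" "b < dim_col (?c \<cdot>\<^sub>m root_vec n i j)"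
  then have ab: "a < 2*n" "b < 2*n" by simp_all
  consider "a = i \<and> b = j" | "a = mirror n j \<and> b = mirror n i"
    | "\<not> (a = i \<and> b = j)" "\<not> (a = mirror n j \<and> b = mirror n i)" by blast
  then have "x $$ (a,b) = ?c * root_vec n i j $$ (a,b)"
  proof cases
    case 1
    then show ?thesis using root_vec_self[OF ij] by simp
  next
    case 2
    then have "x $$ (a,b) = - esign n i * esign n j * x $$ (i,j)"
      "root_vec n i j $$ (a,b) = - esign n i * esign n j * root_vec n i j $$ (i,j)"
      using gC_index[OF x ij] root_vec_other[OF ij] by simp_all
    then show ?thesis using root_vec_self[OF ij] by simp
  next
    case 3
    then show ?thesis using z[OF ab] root_vec_zero[OF ij ab] by simp
  qed
  then show "x $$ (a,b) = (?c \<cdot>\<^sub>m root_vec n i j) $$ (a,b)" using ab by simp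
qed (use carrier_matD[OF gC_carrier[OF x]] in simp_all)

lemma bracket_hsig_root_vec:
  assumes h: "h \<in> hsig n" and ij: "i < 2*n" "j < 2*n"
  shows "bracket h (root_vec n i j) = (h $$ (i,i) - h $$ (j,j)) \<cdot>\<^sub>m root_vec n i j"
proof (rule eq_matI)
  let ?c = "h $$ (i,i) - h $$ (j,j)"
  fix a b assume "a < dim_row (?c \<cdot>\<^sub>m root_vec n i j)" "b < dim_col (?c \<cdot>\<^sub>m root_vec n i j)"
  then have ab: "a < 2*n" "b < 2*n" by simp_all
  have "bracket h (root_vec n i j) $$ (a,b) = (h $$ (a,a) - h $$ (b,b)) * root_vec n i j $$ (a,b)"
    by (subst hsig_eq_diag_fun[OF h], subst bracket_diag_fun_index) (use ab in simp_all)
  also have "\<dots> = ?c * root_vec n i j $$ (a,b)"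
  proof -
    consider "a = i \<and> b = j" | "a = mirror n j \<and> b = mirror n i"
      | "\<not> (a = i \<and> b = j)" "\<not> (a = mirror n j \<and> b = mirror n i)" by blast
    then show ?thesis
    proof cases
      case 2
      \<comment> \<open>Mirroring negates the two diagonal entries and exchanges their roles, so
        their difference is unchanged.\<close>
      then have "h $$ (a,a) = - h $$ (j,j)" "h $$ (b,b) = - h $$ (i,i)"
        using hsig_mirror[OF h] ij by simp_all
      then show ?thesis by simp
    qed (use root_vec_zero[OF ij ab] in simp_all)
  qed
  finally show "bracket h (root_vec n i j) $$ (a,b) = (?c \<cdot>\<^sub>m root_vec n i j) $$ (a,b)" using ab by simp
qed (use bracket_dim[OF hsig_carrier[OF h]] in simp_all)

section \<open>Separation of roots, coroots, and brackets of matrix units\<close>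

lemma bracket_swap:
  "x \<in> carrier_mat N N \<Longrightarrow> y \<in> carrier_mat N N \<Longrightarrow> bracket x y = (-1) \<cdot>\<^sub>m bracket y x"
  unfolding bracket_def by (intro eq_matI) (auto simp del: index_mult_mat(1))

text \<open>The diagonal of \<open>d\<^sub>i - 2 d\<^sub>j\<close>, where \<open>d\<^sub>k = E\<^sub>k\<^sub>k - E\<^sub>k\<^sub>'\<^sub>k\<^sub>'\<close>: a single
  element of \<open>\<hh>\<^sup>\<sigma>\<close> that isolates the root \<open>\<epsilon>\<^sub>i - \<epsilon>\<^sub>j\<close>.\<close>

definition sep_wt :: "nat \<Rightarrow> nat \<Rightarrow> nat \<Rightarrow> nat \<Rightarrow> int" where
  "sep_wt n i j a = (if a = i then 1 else 0) - (if a = mirror n i then 1 else 0)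
     - 2 * ((if a = j then 1 else 0) - (if a = mirror n j then 1 else 0))"

lemma sep_wt_mirror:
  assumes "i < 2*n" "j < 2*n" "a < 2*n"
  shows "sep_wt n i j (mirror n a) = - sep_wt n i j a"
  using assms mirror_swap[of a n i] mirror_swap[of a n j] by (simp add: sep_wt_def)

text \<open>Generically the values at i, j, i', j' are 1, -2, -1, 2, and 0 elsewhere; the difference
  3 arises only as 1-(-2) and 2-(-1). With d_i - d_j in place of d_i - 2 d_j, the pairs (i,i') and
  (j',j) would share the difference of (i,j). For j = i' the values are 3, -3 and 0.\<close>

lemma sep_wt_separates:
  assumes ij: "i < 2*n" "j < 2*n" "i \<noteq> j" and ab: "a < 2*n" "b < 2*n"
    and eq: "sep_wt n i j a - sep_wt n i j b = sep_wt n i j i - sep_wt n i j j"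
  shows "a = i \<and> b = j \<or> a = mirror n j \<and> b = mirror n i"
proof (cases "j = mirror n i")
  case True
  have "sep_wt n i j c = (if c = i then 3 else if c = mirror n i then -3 else 0)" if "c < 2*n" for c
    using True ij that by (simp add: sep_wt_def)
  then show ?thesis using True ij ab eq by (auto split: if_splits)
next
  case False
  then have F: "mirror n i \<noteq> j" "i \<noteq> mirror n j" "mirror n j \<noteq> i" using ij mirror_swap[of i n j] by auto
  have w: "sep_wt n i j i = 1" "sep_wt n i j j = -2" "sep_wt n i j (mirror n i) = -1" "sep_wt n i j (mirror n j) = 2"
    using False F ij by (simp_all add: sep_wt_def)
  have "c = i \<or> c = j \<or> c = mirror n i \<or> c = mirror n j \<or> sep_wt n i j c = 0" for c
    by (simp add: sep_wt_def)
  from this[of a] this[of b] show ?thesis using eq w by (elim disjE) simp_all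
qed

text \<open>For a long root both root vectors are doubled, so the bracket is 4 (E_ii - E_jj). The
  diagonal matrix on the right supplies one factor 2 and the conditional scalar the other.\<close>

lemma coroot_bracket:
  assumes ij: "i < 2*n" "j < 2*n" "i \<noteq> j"
  shows "bracket (root_vec n i j) (root_vec n j i) = (if j = mirror n i then 2 else 1) \<cdot>\<^sub>m
    diag_fun (2*n) (\<lambda>a. (if a = i then 1 else 0) - (if a = j then 1 else 0) - (if a = mirror n i then 1 else 0) + (if a = mirror n j then 1 else 0))"
    (is "?L = ?R")
proof (rule eq_matI)
  fix a b assume "a < dim_row ?R" "b < dim_col ?R"
  then have ab: "a < 2*n" "b < 2*n" by simp_all
  have ss: "esign n i * esign n j * (esign n j * esign n i) = 1" "esign n j * esign n i * (esign n i * esign n j) = 1" by (simp_all add: esign_def)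
  show "?L $$ (a,b) = ?R $$ (a,b)"
  proof (cases "j = mirror n i")
    case True
    then show ?thesis using ij(1) ab by (simp add: bracket_root_vec_index root_vec_index)
  next
    case False
    then have F: "mirror n i \<noteq> j" "i \<noteq> mirror n j" "mirror n j \<noteq> i" using ij mirror_swap[of i n j] by auto
    show ?thesis using ij ab F False ij(3)[symmetric] ss
      by (simp add: bracket_root_vec_index root_vec_index)
  qed
qed (use bracket_dim[OF root_vec_carrier[of n i j] root_vec_carrier[of n j i]] in simp_all)

lemma is_msubspace_sl: "is_msubspace (2*n) (sl n)"
  by (auto simp: is_msubspace_def sl_def mtrace_def sum.distrib sum_distrib_left[symmetric])

lemma sigma_alg_add:
  "x \<in> carrier_mat (2*n) (2*n) \<Longrightarrow> y \<in> carrier_mat (2*n) (2*n) \<Longrightarrow>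
    sigma_alg n (x + y) = sigma_alg n x + sigma_alg n y"
  by (intro eq_matI) (simp_all add: sigma_alg_index distrib_left)

lemma sigma_alg_smult:
  "x \<in> carrier_mat (2*n) (2*n) \<Longrightarrow> sigma_alg n (c \<cdot>\<^sub>m x) = c \<cdot>\<^sub>m sigma_alg n x"
  by (intro eq_matI) (simp_all add: sigma_alg_index)

lemma bracket_unitE_diagonal:
  assumes "h \<in> carrier_mat N N" "diagonal_mat h" "k < N" "l < N"
  shows "bracket (unitE N k l) h = (h $$ (l,l) - h $$ (k,k)) \<cdot>\<^sub>m unitE N k l"
proof (rule eq_matI)
  fix a b assume "a < dim_row ((h $$ (l,l) - h $$ (k,k)) \<cdot>\<^sub>m unitE N k l)" "b < dim_col ((h $$ (l,l) - h $$ (k,k)) \<cdot>\<^sub>m unitE N k l)"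
  then have ab: "a < N" "b < N" by simp_all
  have "h $$ (a,b) = 0" if "a < N" "b < N" "a \<noteq> b" for a b
    using assms(1,2) that by (auto simp: diagonal_mat_def)
  then show "bracket (unitE N k l) h $$ (a,b) = ((h $$ (l,l) - h $$ (k,k)) \<cdot>\<^sub>m unitE N k l) $$ (a,b)"
    using ab assms(3,4) by (auto simp: bracket_unitE_index[OF assms(1)])
qed (use bracket_dim[OF unitE_carrier assms(1)] in simp_all)

lemma bracket_unitE_unitE:
  assumes "k < N" "l < N" "i < N" "j < N"
  shows "bracket (unitE N k l) (unitE N i j)
    = (if l = i then unitE N k j else 0\<^sub>m N N) - (if j = k then unitE N i l else 0\<^sub>m N N)"
  using assms by (intro eq_matI) (auto simp: bracket_unitE_index bracket_dim[where N=N])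

section \<open>Inverses and conjugation by upper triangular matrices\<close>

text \<open>\<open>minv\<close> is a choice, so it is computed by exhibiting a right inverse, which
  for square matrices is two-sided.\<close>

lemma minv_unique:
  assumes "A \<in> carrier_mat N N" "B \<in> carrier_mat N N" "A * B = 1\<^sub>m N"
  shows "minv A = B"
proof -
  have BA: "B * A = 1\<^sub>m N" using mat_mult_left_right_inverse[OF assms] .
  have "minv A \<in> carrier_mat N N \<and> A * minv A = 1\<^sub>m N \<and> minv A * A = 1\<^sub>m N"
    unfolding minv_def carrier_matD[OF assms(1)]
    by (rule someI[of "\<lambda>B. B \<in> carrier_mat N N \<and> A * B = 1\<^sub>m N \<and> B * A = 1\<^sub>m N" B]) (use assms BA in blast)
  then have m: "minv A \<in> carrier_mat N N" "A * minv A = 1\<^sub>m N" by auto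
  have "minv A = (B * A) * minv A" using m BA by simp
  also have "\<dots> = B * (A * minv A)" using assms m by (intro assoc_mult_mat) auto
  also have "\<dots> = B" using m assms by simp
  finally show ?thesis .
qed

lemma invertible_ex:
  assumes "A \<in> carrier_mat N N" "det A \<noteq> (0::complex)"
  obtains B where "B \<in> carrier_mat N N" "A * B = 1\<^sub>m N" "B * A = 1\<^sub>m N"
  using det_non_zero_imp_unit[OF assms, of "()"] unfolding Units_def ring_mat_def by auto

lemma minv:
  assumes "A \<in> carrier_mat N N" "det A \<noteq> (0::complex)"
  shows "minv A \<in> carrier_mat N N" "A * minv A = 1\<^sub>m N" "minv A * A = 1\<^sub>m N"
proof -
  obtain B where "B \<in> carrier_mat N N" "A * B = 1\<^sub>m N" "B * A = 1\<^sub>m N" using invertible_ex[OF assms] .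
  with minv_unique[OF assms(1)]
  show "minv A \<in> carrier_mat N N" "A * minv A = 1\<^sub>m N" "minv A * A = 1\<^sub>m N" by auto
qed

lemma upper_triangular_mult:
  assumes "A \<in> carrier_mat N N" "B \<in> carrier_mat N N" "upper_triangular A" "upper_triangular (B :: complex mat)"
  shows "upper_triangular (A * B)"
proof (rule upper_triangularI)
  fix i j assume ij: "j < i" "i < dim_row (A * B)"
  then have "(A * B) $$ (i,j) = (\<Sum>k<N. A $$ (i,k) * B $$ (k,j))"
    using assms by (subst index_mult_sum) auto
  also have "\<dots> = 0"
  proof (rule sum.neutral, rule ballI)
    fix k assume "k \<in> {..<N}"
    then show "A $$ (i,k) * B $$ (k,j) = 0"
      using ij assms upper_triangularD[OF assms(3), of k i] upper_triangularD[OF assms(4), of j k] by (cases "k < i") auto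
  qed
  finally show "(A * B) $$ (i,j) = 0" .
qed

lemma upper_triangular_diag_nz:
  assumes "A \<in> carrier_mat N N" "upper_triangular A" "det A \<noteq> (0::complex)" "i < N"
  shows "A $$ (i,i) \<noteq> 0"
  using assms upper_triangular_imp_det_eq_0_iff[OF assms(1,2)] by (auto simp: diag_mat_def)

lemma upper_triangular_inverse:
  assumes A: "A \<in> carrier_mat N N" "upper_triangular A" and B: "B \<in> carrier_mat N N"
    and AB: "A * B = 1\<^sub>m N" and nz: "\<And>i. i < N \<Longrightarrow> A $$ (i,i) \<noteq> (0::complex)"
  shows "upper_triangular B"
proof (rule upper_triangularI)
  \<comment> \<open>\<open>d\<close> counts rows from the bottom: this is back substitution.\<close>
  have *: "\<forall>i. i + d = N \<longrightarrow> (\<forall>j<i. i < N \<longrightarrow> B $$ (i,j) = 0)" for d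
  proof (induction d rule: less_induct)
    case (less d)
    show ?case
    proof (intro allI impI)
      fix i j assume i: "i + d = N" "j < i" "i < N"
      have "0 = (\<Sum>k<N. A $$ (i,k) * B $$ (k,j))"
        using arg_cong[OF AB, of "\<lambda>M. M $$ (i,j)"] A B i by (subst (asm) index_mult_sum) auto
      also have "\<dots> = A $$ (i,i) * B $$ (i,j)"
      proof (rule sum_eq_single)
        fix k assume k: "k < N" "k \<noteq> i"
        show "A $$ (i,k) * B $$ (k,j) = 0"
        proof (cases "k < i")
          case True
          then show ?thesis using upper_triangularD[OF A(2), of k i] A i by auto
        next
          case False
          then have "B $$ (k,j) = 0" using less.IH[of "N - k"] k i by auto
          then show ?thesis by simp
        qed
      qed (use i in simp)
      finally show "B $$ (i,j) = 0" using nz[of i] i by simp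
    qed
  qed
  fix i j assume "j < i" "i < dim_row B"
  then show "B $$ (i,j) = 0" using *[of "N - i"] B by auto
qed

lemma upper_triangular_minv:
  assumes "A \<in> carrier_mat N N" "upper_triangular A" "det A \<noteq> (0::complex)"
  shows "upper_triangular (minv A)"
  using upper_triangular_inverse[OF assms(1,2) minv(1,2)[OF assms(1,3)]] upper_triangular_diag_nz[OF assms] by blast

text \<open>For square-zero \<open>\<nu>\<close> one has \<open>\<nu> y \<nu> = - [\<nu>,[\<nu>,y]] / 2\<close>, so conjugation by \<open>1 + \<nu>\<close> is a polynomial in \<open>ad \<nu>\<close>.\<close>

lemma conj_square_zero:
  assumes v: "v \<in> carrier_mat N N" "v * v = 0\<^sub>m N N" and y: "y \<in> carrier_mat N N"
  shows "(1\<^sub>m N + v) * y * (1\<^sub>m N - v) = y + bracket v y + (1/2) \<cdot>\<^sub>m bracket v (bracket v y)"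
proof -
  let ?a = "v * y" and ?b = "y * v"
  have c: "?a \<in> carrier_mat N N" "?b \<in> carrier_mat N N" "?a * v \<in> carrier_mat N N" using v y by auto
  have 1: "v * ?a = 0\<^sub>m N N" using v y by (simp add: assoc_mult_mat[symmetric, of _ N N _ N _ N])
  have 2: "?b * v = 0\<^sub>m N N" using v y by (simp add: assoc_mult_mat[of _ N N _ N _ N])
  have 3: "v * ?b = ?a * v" using v y by (simp add: assoc_mult_mat[of _ N N _ N _ N])
  have "bracket v (bracket v y) = (v * ?a - v * ?b) - (?a * v - ?b * v)"
    unfolding bracket_def using v y c
    by (simp add: mult_minus_distrib_mat[of _ N N _ N] minus_mult_distrib_mat[of _ N N _ _ N])
  moreover have "(0\<^sub>m N N - w) - (w - 0\<^sub>m N N) = (-2) \<cdot>\<^sub>m w" if "w \<in> carrier_mat N N" for w :: "complex mat"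
    using that by (intro eq_matI) auto
  ultimately have bb: "bracket v (bracket v y) = (-2) \<cdot>\<^sub>m (?a * v)"
    unfolding 1 2 3 using c by simp
  have "(1\<^sub>m N + v) * y * (1\<^sub>m N - v) = (y + ?a) * 1\<^sub>m N - (y + ?a) * v"
    using v y c by (simp add: add_mult_distrib_mat[of _ N N] mult_minus_distrib_mat[of _ N N _ N])
  also have "(y + ?a) * v = ?b + ?a * v" using v y c by (simp add: add_mult_distrib_mat[of _ N N])
  also have "(y + ?a) * 1\<^sub>m N = y + ?a" using v y c by simp
  also have "y + a - (b + w) = y + (a - b) + (1/2) \<cdot>\<^sub>m ((-2) \<cdot>\<^sub>m w)"
    if "a \<in> carrier_mat N N" "b \<in> carrier_mat N N" "w \<in> carrier_mat N N" for a b w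
    using that y by (intro eq_matI) auto
  from this[OF c] have "y + ?a - (?b + ?a * v) = y + (?a - ?b) + (1/2) \<cdot>\<^sub>m ((-2) \<cdot>\<^sub>m (?a * v))" .
  finally show ?thesis unfolding bb unfolding bracket_def .
qed

text \<open>Factorization into matrices that differ from the identity in one row only.\<close>

lemma upper_triangular_row_induct:
  assumes c: "c \<in> carrier_mat N N" "upper_triangular (c :: complex mat)"
    and one: "P (1\<^sub>m N)"
    and step: "\<And>X k. X \<in> carrier_mat N N \<Longrightarrow> k < N \<Longrightarrow> P X \<Longrightarrow>
      P (X * mat N N (\<lambda>(a,b). if a = k then c $$ (k,b) else if a = b then 1 else 0))"
  shows "P c"
proof -
  \<comment> \<open>\<open>X k\<close> has the rows of \<open>c\<close> from \<open>k\<close> on and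
    those of the identity above; it runs from the identity at \<open>k = N\<close> to
    \<open>c\<close> at \<open>k = 0\<close>.\<close>
  define X where "X k = mat N N (\<lambda>(a,b). if k \<le> a then c $$ (a,b) else if a = b then 1 else 0)" for k
  have XN: "X N = 1\<^sub>m N" by (intro eq_matI) (auto simp: X_def)
  have X0: "X 0 = c" using c by (intro eq_matI) (auto simp: X_def)
  have Xs: "X k = X (Suc k) * mat N N (\<lambda>(a,b). if a = k then c $$ (k,b) else if a = b then 1 else 0)" (is "_ = _ * ?R")
    if k: "k < N" for k
  proof (rule eq_matI)
    fix a b assume "a < dim_row (X (Suc k) * ?R)" "b < dim_col (X (Suc k) * ?R)"
    then have ab: "a < N" "b < N" by (simp_all add: X_def)
    have "(X (Suc k) * ?R) $$ (a,b) = (\<Sum>m<N. X (Suc k) $$ (a,m) * ?R $$ (m,b))"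
      using ab by (subst index_mult_sum) (simp_all add: X_def)
    also have "\<dots> = X k $$ (a,b)"
    proof (cases "Suc k \<le> a")
      case False
      have "(\<Sum>m<N. X (Suc k) $$ (a,m) * ?R $$ (m,b)) = X (Suc k) $$ (a,a) * ?R $$ (a,b)"
        using False ab k by (intro sum_eq_single) (auto simp: X_def)
      also have "\<dots> = X k $$ (a,b)" using False ab k by (cases "a = k") (auto simp: X_def)
      finally show ?thesis .
    next
      case True
      \<comment> \<open>Below row \<open>k\<close>, the nontrivial row of \<open>?R\<close> is met
        only by entries of column \<open>k\<close> of \<open>c\<close>, which vanish under the
        diagonal.\<close>
      have z: "c $$ (a,k) = 0" using True upper_triangularD[OF c(2), of k a] c(1) ab by auto
      have "(\<Sum>m<N. X (Suc k) $$ (a,m) * ?R $$ (m,b)) = X (Suc k) $$ (a,b) * ?R $$ (b,b)"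
        using True ab k z by (intro sum_eq_single) (auto simp: X_def)
      also have "\<dots> = X k $$ (a,b)" using True ab k z by (auto simp: X_def)
      finally show ?thesis .
    qed
    finally show "X k $$ (a,b) = (X (Suc k) * ?R) $$ (a,b)" by simp
  qed (simp_all add: X_def)
  have Xc: "X k \<in> carrier_mat N N" for k by (simp add: X_def)
  have "P (X k)" if "k \<le> N" for k
    using that
  proof (induction rule: inc_induct)
    case base
    show ?case using one by (simp add: XN)
  next
    case (step k)
    then show ?case using assms(4)[OF Xc] Xs by simp
  qed
  from this[of 0] show ?thesis by (simp add: X0)
qed


lemma diag_fun_conj_index:
  assumes "y \<in> carrier_mat N N" "a < N" "b < N"
  shows "(diag_fun N f * y * diag_fun N g) $$ (a,b) = f a * y $$ (a,b) * g b"
proof -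
  have "(diag_fun N f * y * diag_fun N g) $$ (a,b) = (\<Sum>k<N. (diag_fun N f * y) $$ (a,k) * diag_fun N g $$ (k,b))"
    using assms by (subst index_mult_sum) auto
  also have "\<dots> = (diag_fun N f * y) $$ (a,b) * diag_fun N g $$ (b,b)"
    using assms by (intro sum_eq_single) (auto simp del: index_mult_mat(1))
  also have "(diag_fun N f * y) $$ (a,b) = (\<Sum>k<N. diag_fun N f $$ (a,k) * y $$ (k,b))"
    using assms by (subst index_mult_sum) auto
  also have "\<dots> = diag_fun N f $$ (a,a) * y $$ (a,b)"
    using assms by (intro sum_eq_single) auto
  finally show ?thesis using assms by simp
qed

text \<open>The analogue of \<open>is_msubspace_bracket\<close> for conjugation: invariance of a
  span can be tested on generators.\<close>

lemma is_msubspace_conj: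
  assumes V: "is_msubspace N V" and A: "A \<in> carrier_mat N N" "B \<in> carrier_mat N N"
  shows "is_msubspace N {y \<in> carrier_mat N N. A * y * B \<in> V}"
proof -
  have "A * (x + y) * B = A * x * B + A * y * B" "A * (c \<cdot>\<^sub>m x) * B = c \<cdot>\<^sub>m (A * x * B)"
    if "x \<in> carrier_mat N N" "y \<in> carrier_mat N N" for x y c
    using that A by (simp_all add: mult_add_distrib_mat[of _ N N _ N] add_mult_distrib_mat[of _ N N _ _ N]
      mult_smult_distrib[of _ N N _ N] mult_smult_assoc_mat[of _ N N _ N])
  moreover have "A * 0\<^sub>m N N * B = 0\<^sub>m N N" using A by simp
  ultimately show ?thesis using V by (auto simp: is_msubspace_def)
qed

section \<open>The type A space generated by a type C Hessenberg space\<close>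

context
  fixes n :: nat and HC :: "complex mat set"
  assumes hess: "hessC n HC"
begin

section \<open>Root decomposition of \<open>HC\<close>\<close>

lemma HC_subspace: "is_msubspace (2*n) HC"
  and HC_gC: "x \<in> HC \<Longrightarrow> x \<in> gC n"
  and HC_bracket: "b \<in> bC n \<Longrightarrow> x \<in> HC \<Longrightarrow> bracket b x \<in> HC"
  using hess unfolding hessC_def by auto

lemma HC_carrier: "x \<in> HC \<Longrightarrow> x \<in> carrier_mat (2*n) (2*n)"
  using HC_gC gC_carrier by blast

text \<open>Projection of \<open>HC\<close> onto an eigenspace of \<open>ad h\<close>: multiply by the remaining factors \<open>ad h - \<mu>\<close>.\<close>

lemma HC_weight_component:
  fixes f :: "nat \<Rightarrow> complex"
  assumes f: "\<And>a. a < 2*n \<Longrightarrow> f (mirror n a) = - f a" and x: "x \<in> HC"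
  shows "mat (2*n) (2*n) (\<lambda>(a,b). if f a - f b = c then x $$ (a,b) else 0) \<in> HC"
proof -
  \<comment> \<open>The weights other than \<open>c\<close>: the product over \<open>W\<close> kills
    their entries and is a nonzero scalar on the entries of weight \<open>c\<close>.\<close>
  define W where "W = (\<lambda>(a,b). f a - f b) ` ({..<2*n} \<times> {..<2*n}) - {c}"
  have "finite W" unfolding W_def by simp
  have prod: "mat (2*n) (2*n) (\<lambda>(a,b). (\<Prod>\<mu>\<in>W. f a - f b - \<mu>) * x $$ (a,b)) \<in> HC"
    using \<open>finite W\<close>
  proof (induction W rule: finite_induct)
    case empty
    have "mat (2*n) (2*n) (\<lambda>(a,b). (\<Prod>\<mu>\<in>{}. f a - f b - \<mu>) * x $$ (a,b)) = x"
      using HC_carrier[OF x] by (intro eq_matI) auto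
    then show ?case using x by (simp only:)
  next
    case (insert \<nu> W)
    let ?y = "mat (2*n) (2*n) (\<lambda>(a,b). (\<Prod>\<mu>\<in>W. f a - f b - \<mu>) * x $$ (a,b))"
    have "mat (2*n) (2*n) (\<lambda>(a,b). (\<Prod>\<mu>\<in>insert \<nu> W. f a - f b - \<mu>) * x $$ (a,b))
        = bracket (diag_fun (2*n) f) ?y - \<nu> \<cdot>\<^sub>m ?y"
      using insert.hyps by (intro eq_matI) (auto simp: bracket_diag_fun_index algebra_simps bracket_dim[where N="2*n"])
    then show ?case
      using insert.IH HC_subspace HC_bracket[OF hsig_bC[OF diag_fun_in_hsig[of n f]]] f
      by (auto intro!: msubspace_minus[of "2*n"] msubspace_smult[of "2*n"])
  qed
  have nz: "(\<Prod>\<mu>\<in>W. c - \<mu>) \<noteq> 0" using \<open>finite W\<close> unfolding W_def by auto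
  have "mat (2*n) (2*n) (\<lambda>(a,b). if f a - f b = c then x $$ (a,b) else 0)
      = (1 / (\<Prod>\<mu>\<in>W. c - \<mu>)) \<cdot>\<^sub>m mat (2*n) (2*n) (\<lambda>(a,b). (\<Prod>\<mu>\<in>W. f a - f b - \<mu>) * x $$ (a,b))"
    (is "?L = ?R")
  proof (rule eq_matI)
    fix a b assume "a < dim_row ?R" "b < dim_col ?R"
    then have ab: "a < 2*n" "b < 2*n" by simp_all
    show "?L $$ (a,b) = ?R $$ (a,b)"
    proof (cases "f a - f b = c")
      case True
      then show ?thesis using ab nz by simp
    next
      case False
      then have "f a - f b \<in> W" using ab unfolding W_def by auto
      then have "(\<Prod>\<mu>\<in>W. f a - f b - \<mu>) = 0" using \<open>finite W\<close> by (intro prod_zero) auto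
      then show ?thesis using ab False by simp
    qed
  qed simp_all
  then show ?thesis using prod msubspace_smult[OF HC_subspace] by simp
qed

text \<open>The weight of (i,j) under the \<open>sep_wt\<close> diagonal occurs only at the two
  positions of the root. Projecting \<open>x\<close> to it therefore leaves a nonzero multiple of
  the root vector.\<close>

lemma root_vec_in_HC:
  assumes x: "x \<in> HC" and ij: "i < 2*n" "j < 2*n" "i \<noteq> j" and nz: "x $$ (i,j) \<noteq> 0"
  shows "root_vec n i j \<in> HC"
proof -
  let ?f = "\<lambda>a. of_int (sep_wt n i j a) :: complex"
  let ?y = "mat (2*n) (2*n) (\<lambda>(a,b). if ?f a - ?f b = ?f i - ?f j then x $$ (a,b) else 0)"
  have y: "?y \<in> HC" using ij x by (intro HC_weight_component) (simp_all add: sep_wt_mirror)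
  have eq: "?y = (?y $$ (i,j) / root_vec n i j $$ (i,j)) \<cdot>\<^sub>m root_vec n i j"
  proof (rule gC_eq_root_vec[OF HC_gC[OF y] ij(1,2)])
    fix a b assume ab: "a < 2*n" "b < 2*n" "\<not> (a = i \<and> b = j)" "\<not> (a = mirror n j \<and> b = mirror n i)"
    then have "sep_wt n i j a - sep_wt n i j b \<noteq> sep_wt n i j i - sep_wt n i j j" using sep_wt_separates[OF ij ab(1,2)] by blast
    then have "?f a - ?f b \<noteq> ?f i - ?f j" by (metis of_int_diff of_int_eq_iff)
    then show "?y $$ (a,b) = 0" using ab(1,2) by simp
  qed
  define c where "c = x $$ (i,j) / root_vec n i j $$ (i,j)"
  have "c \<noteq> 0" using nz root_vec_self[OF ij(1,2)] by (simp add: c_def)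
  have "?y = c \<cdot>\<^sub>m root_vec n i j" using eq ij unfolding c_def by simp
  then have "c \<cdot>\<^sub>m root_vec n i j \<in> HC" using y by simp
  then have "(1/c) \<cdot>\<^sub>m (c \<cdot>\<^sub>m root_vec n i j) \<in> HC" by (rule msubspace_smult[OF HC_subspace])
  moreover have "(1/c) \<cdot>\<^sub>m (c \<cdot>\<^sub>m root_vec n i j) = root_vec n i j" using \<open>c \<noteq> 0\<close> by (intro eq_matI) auto
  ultimately show ?thesis by simp
qed

text \<open>\<open>rootspace\<close> tests against all of \<open>hsig\<close>; the single
  \<open>sep_wt\<close> diagonal already forces a multiple of \<open>root_vec\<close>.\<close>

lemma PhiH_iff: "(i,j) \<in> PhiH n HC \<longleftrightarrow> i < 2*n \<and> j < 2*n \<and> i \<noteq> j \<and> root_vec n i j \<in> HC"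
proof -
  have "rootspace n i j \<subseteq> HC \<longleftrightarrow> root_vec n i j \<in> HC" if ij: "i < 2*n" "j < 2*n" "i \<noteq> j"
  proof
    assume "rootspace n i j \<subseteq> HC"
    moreover have "root_vec n i j \<in> rootspace n i j"
      using root_vec_gC[OF ij(1,2)] bracket_hsig_root_vec[OF _ ij(1,2)] by (simp add: rootspace_def)
    ultimately show "root_vec n i j \<in> HC" by blast
  next
    assume root_vec: "root_vec n i j \<in> HC"
    show "rootspace n i j \<subseteq> HC"
    proof
      fix x assume "x \<in> rootspace n i j"
      then have x: "x \<in> gC n" and sep_wt: "\<And>h. h \<in> hsig n \<Longrightarrow> bracket h x = (h $$ (i,i) - h $$ (j,j)) \<cdot>\<^sub>m x"
        by (auto simp: rootspace_def)
      note xc = gC_carrier[OF x]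
      let ?f = "\<lambda>a. of_int (sep_wt n i j a) :: complex"
      have "diag_fun (2*n) ?f \<in> hsig n" using ij by (intro diag_fun_in_hsig) (simp add: sep_wt_mirror)
      note b = sep_wt[OF this]
      have "x = (x $$ (i,j) / root_vec n i j $$ (i,j)) \<cdot>\<^sub>m root_vec n i j"
      proof (rule gC_eq_root_vec[OF x ij(1,2)])
        fix a b assume ab: "a < 2*n" "b < 2*n" "\<not> (a = i \<and> b = j)" "\<not> (a = mirror n j \<and> b = mirror n i)"
        then have "sep_wt n i j a - sep_wt n i j b \<noteq> sep_wt n i j i - sep_wt n i j j" using sep_wt_separates[OF ij ab(1,2)] by blast
        then have ne: "?f a - ?f b \<noteq> ?f i - ?f j" by (metis of_int_diff of_int_eq_iff)
        have "(?f a - ?f b) * x $$ (a,b) = (?f i - ?f j) * x $$ (a,b)"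
          using arg_cong[OF b, of "\<lambda>m. m $$ (a,b)"] bracket_diag_fun_index[OF xc ab(1,2)] ij ab(1,2) xc by simp
        then show "x $$ (a,b) = 0" using ne by simp
      qed
      then show "x \<in> HC" using msubspace_smult[OF HC_subspace root_vec] by metis
    qed
  qed
  then show ?thesis by (auto simp: PhiH_def)
qed

section \<open>Closure properties of \<open>PhiH\<close>\<close>

lemma PhiH_I:
  "x \<in> HC \<Longrightarrow> i < 2*n \<Longrightarrow> j < 2*n \<Longrightarrow> i \<noteq> j \<Longrightarrow> x $$ (i,j) \<noteq> 0 \<Longrightarrow> (i,j) \<in> PhiH n HC"
  by (simp add: PhiH_iff root_vec_in_HC)

lemma PhiH_D:
  assumes "(i,j) \<in> PhiH n HC"
  shows "i < 2*n" "j < 2*n" "i \<noteq> j" "root_vec n i j \<in> HC"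
  using assms by (simp_all add: PhiH_iff)

text \<open>Both pairs restrict to the same root; concretely, the root vector is nonzero at the
  mirrored position too.\<close>

lemma PhiH_mirror: "(i,j) \<in> PhiH n HC \<Longrightarrow> (mirror n j, mirror n i) \<in> PhiH n HC"
proof -
  assume "(i,j) \<in> PhiH n HC"
  note ij = PhiH_D[OF this]
  show ?thesis by (rule PhiH_I[OF ij(4)]) (use ij root_vec_other[OF ij(1,2)] root_vec_self[OF ij(1,2)] in auto)
qed

text \<open>The bracket of the root vectors of (k,i) and (i,j) is nonzero at (k,j). The mirrored
  halves contribute there only if (k,i) or (k,j) is a long pair, and then with the same sign, so the
  entry is \<open>?r\<close> or twice that.\<close>

lemma PhiH_left:
  assumes "(i,j) \<in> PhiH n HC" "k < i" "k \<noteq> j"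
  shows "(k,j) \<in> PhiH n HC"
proof -
  note ij = PhiH_D[OF assms(1)]
  have k: "k < 2*n" using ij assms by simp
  let ?x = "bracket (root_vec n k i) (root_vec n i j)"
  let ?r = "root_vec n i j $$ (i,j)"
  have x: "?x \<in> HC" using root_vec_bC[OF assms(2) ij(1)] ij(4) by (rule HC_bracket)
  have "?x $$ (k,j) = ?r - esign n k * esign n i * ((if k = mirror n i then root_vec n i j $$ (mirror n k, j) else 0)
      - (if j = mirror n k then root_vec n i j $$ (k, mirror n i) else 0))"
    using bracket_root_vec_index[OF root_vec_carrier k ij(1) k ij(2), of i j] ij(3) by simp
  moreover have "\<dots> = (if k = mirror n i \<or> j = mirror n k then 2 else 1) * ?r"
  proof -
    consider "k = mirror n i" | "j = mirror n k" "k \<noteq> mirror n i" | "j \<noteq> mirror n k" "k \<noteq> mirror n i" by blast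
    then show ?thesis
    proof cases
      case 1
      then show ?thesis using ij by simp
    next
      case 2
      then have "k = mirror n j" using k by simp
      then have "root_vec n i j $$ (k, mirror n i) = - esign n i * esign n j * ?r" "esign n k = - esign n j"
        using root_vec_other[OF ij(1,2)] ij by simp_all
      then show ?thesis using 2 by (simp add: esign_def)
    qed simp
  qed
  ultimately have "?x $$ (k,j) \<noteq> 0" using root_vec_self[OF ij(1,2)] by simp
  with x show ?thesis using k ij assms by (intro PhiH_I) auto
qed

text \<open>\<open>PhiH_left\<close> conjugated by the symmetry (i,j) -> (j',i'), which exchanges
  rows and columns.\<close>

lemma PhiH_right:
  assumes "(i,j) \<in> PhiH n HC" "j < k" "k < 2*n" "i \<noteq> k"
  shows "(i,k) \<in> PhiH n HC"
proof -
  note ij = PhiH_D[OF assms(1)]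
  have "(mirror n k, mirror n i) \<in> PhiH n HC"
    using PhiH_left[OF PhiH_mirror[OF assms(1)], of "mirror n k"] assms ij by simp
  from PhiH_mirror[OF this] show ?thesis using ij assms by simp
qed

text \<open>\<open>HC\<close> need not be closed under brackets of its own elements, so this is
  composed from moves by positive roots. If i < j, move (j,k) up to row i; otherwise j < i < k, and
  (i,j) moves right to column k.\<close>

lemma PhiH_trans:
  assumes "(i,j) \<in> PhiH n HC" "(j,k) \<in> PhiH n HC" "i < k"
  shows "(i,k) \<in> PhiH n HC"
  using PhiH_left[OF assms(2), of i] PhiH_right[OF assms(1), of k] PhiH_D[OF assms(1)] PhiH_D[OF assms(2)] assms(3)
  by (cases "i < j") auto

text \<open>The bracket of a positive root vector with \<open>h\<close> is a nonzero multiple of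
  that root vector, and it lies in \<open>HC\<close>.\<close>

lemma PhiH_cartan:
  assumes h: "h \<in> HC" "h \<in> hsig n" and kl: "k < l" "l < 2*n" and ne: "h $$ (k,k) \<noteq> h $$ (l,l)"
  shows "(k,l) \<in> PhiH n HC"
proof -
  have k: "k < 2*n" using kl by simp
  have "bracket (root_vec n k l) h = (-1) \<cdot>\<^sub>m ((h $$ (k,k) - h $$ (l,l)) \<cdot>\<^sub>m root_vec n k l)"
    using bracket_swap[OF root_vec_carrier hsig_carrier[OF h(2)]] bracket_hsig_root_vec[OF h(2) k kl(2)] by simp
  moreover have "bracket (root_vec n k l) h \<in> HC" using root_vec_bC[OF kl] h(1) by (rule HC_bracket)
  ultimately have "(-1) \<cdot>\<^sub>m ((h $$ (k,k) - h $$ (l,l)) \<cdot>\<^sub>m root_vec n k l) \<in> HC" by simp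
  then show ?thesis
    by (rule PhiH_I) (use k kl ne root_vec_self[OF k kl(2)] in auto)
qed

text \<open>With h_ij = E_ii - E_jj, this is h_ij + sigma(h_ij).\<close>

abbreviation coroot :: "nat \<Rightarrow> nat \<Rightarrow> complex mat" where
  "coroot i j \<equiv> diag_fun (2*n) (\<lambda>a. (if a = i then 1 else 0) - (if a = j then 1 else 0)
     - (if a = mirror n i then 1 else 0) + (if a = mirror n j then 1 else 0))"

lemma coroot_HC:
  assumes "(i,j) \<in> PhiH n HC" "j < i"
  shows "coroot i j \<in> HC" "coroot j i \<in> HC"
proof -
  note ij = PhiH_D[OF assms(1)]
  have "bracket (root_vec n j i) (root_vec n i j) \<in> HC" using root_vec_bC[OF assms(2) ij(1)] ij(4) by (rule HC_bracket)
  then have "(if i = mirror n j then 2 else 1) \<cdot>\<^sub>m coroot j i \<in> HC"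
    unfolding coroot_bracket[OF ij(2,1) ij(3)[symmetric]] .
  then have *: "c \<cdot>\<^sub>m ((if i = mirror n j then 2 else 1) \<cdot>\<^sub>m coroot j i) \<in> HC" for c
    by (rule msubspace_smult[OF HC_subspace])
  have "(1 / (if i = mirror n j then 2 else 1)) \<cdot>\<^sub>m ((if i = mirror n j then 2 else 1) \<cdot>\<^sub>m coroot j i) = coroot j i"
    by (intro eq_matI) auto
  then show ji: "coroot j i \<in> HC" using *[of "1 / (if i = mirror n j then 2 else 1)"] by (simp only:)
  have "coroot i j = (-1) \<cdot>\<^sub>m coroot j i" by (intro eq_matI) auto
  then show "coroot i j \<in> HC" using msubspace_smult[OF HC_subspace ji, of "-1"] by (simp only:)
qed

text \<open>A negative root in \<open>PhiH\<close> brings its coroot into \<open>HC\<close>, and the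
  opposite root takes different values at \<open>i\<close> and \<open>j\<close> of that coroot, so
  \<open>PhiH_cartan\<close> applies.\<close>

lemma PhiH_opposite:
  assumes "(i,j) \<in> PhiH n HC" "j < i"
  shows "(j,i) \<in> PhiH n HC"
proof (rule PhiH_cartan[OF coroot_HC(1)[OF assms] _ assms(2)])
  note ij = PhiH_D[OF assms(1)]
  show "coroot i j \<in> hsig n"
  proof (rule diag_fun_in_hsig)
    fix a assume a: "a < 2*n"
    have "(mirror n a = i) = (a = mirror n i)" "(mirror n a = j) = (a = mirror n j)" "(mirror n a = mirror n i) = (a = i)" "(mirror n a = mirror n j) = (a = j)"
      using a ij mirror_swap by auto
    then show "(if mirror n a = i then 1 else 0) - (if mirror n a = j then 1 else 0) - (if mirror n a = mirror n i then 1 else 0) + (if mirror n a = mirror n j then 1 else 0)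
      = - ((if a = i then 1 else 0) - (if a = j then 1 else 0) - (if a = mirror n i then 1 else 0) + (if a = mirror n j then 1 else (0::complex)))"
      by simp
  qed
  show "i < 2*n" by fact
  show "coroot i j $$ (j,j) \<noteq> coroot i j $$ (i,i)"
  proof (cases "i = mirror n j")
    case True
    then show ?thesis using ij(2) by simp
  next
    case False
    then have "j \<noteq> mirror n i" using ij mirror_swap[of i n j] by auto
    then show ?thesis using ij False by simp
  qed
qed

section \<open>Generators of \<open>HfromC\<close> and stability under triangular brackets\<close>

abbreviation "cartan_gens \<equiv> (HC \<inter> hsig n) \<union>
     {unitE (2*n) i i - unitE (2*n) j j | i j. (i,j) \<in> PhiH n HC \<and> (j,i) \<in> PhiH n HC}"

abbreviation "root_gens \<equiv> {unitE (2*n) i j | i j. (i,j) \<in> PhiH n HC}"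

lemma gens_carrier: "cartan_gens \<subseteq> carrier_mat (2*n) (2*n)" "root_gens \<subseteq> carrier_mat (2*n) (2*n)"
  using hsig_carrier by auto

lemma HfromC_eq: "HfromC n HC = mspan (2*n) (cartan_gens \<union> root_gens)"
  unfolding HfromC_def Hcart_def mspan_Un[OF gens_carrier] by blast

lemma HfromC_subspace: "is_msubspace (2*n) (HfromC n HC)"
  unfolding HfromC_eq using gens_carrier by (intro is_msubspace_mspan) blast

text \<open>Serves as an induction principle: a linear property of \<open>HfromC\<close> is checked
  on three kinds of generators.\<close>

lemma HfromC_least:
  assumes "is_msubspace (2*n) V" "cartan_gens \<subseteq> V" "root_gens \<subseteq> V"
  shows "HfromC n HC \<subseteq> V"
  unfolding HfromC_eq using assms by (intro mspan_least) auto

lemma HfromC_cartan: "h \<in> HC \<Longrightarrow> h \<in> hsig n \<Longrightarrow> h \<in> HfromC n HC"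
  and HfromC_diff: "(i,j) \<in> PhiH n HC \<Longrightarrow> (j,i) \<in> PhiH n HC \<Longrightarrow> unitE (2*n) i i - unitE (2*n) j j \<in> HfromC n HC"
  and HfromC_root: "(i,j) \<in> PhiH n HC \<Longrightarrow> unitE (2*n) i j \<in> HfromC n HC"
  unfolding HfromC_eq by (auto intro!: mspan.gen)

lemma cartan_gens_diagonal: "h \<in> cartan_gens \<Longrightarrow> h \<in> carrier_mat (2*n) (2*n) \<and> diagonal_mat h"
  using hsig_carrier[of h n] hsig_offdiag[of h n] by (auto simp: diagonal_mat_def)

text \<open>These are the positive E_kl that do not commute with \<open>h\<close>. For h = E_ii -
  E_jj, one of k, l is i or j. If k = i and l differs from j, then (j,i) moves right to (j,l), and
  composing with (i,j) gives (i,l); the case l = i is similar with a move up.\<close>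

lemma cartan_gens_PhiH:
  assumes h: "h \<in> cartan_gens" and kl: "k < l" "l < 2*n" and ne: "h $$ (k,k) \<noteq> h $$ (l,l)"
  shows "(k,l) \<in> PhiH n HC"
  using h
proof
  assume "h \<in> HC \<inter> hsig n"
  then show ?thesis using PhiH_cartan[OF _ _ kl ne] by blast
next
  assume "h \<in> {unitE (2*n) i i - unitE (2*n) j j | i j. (i,j) \<in> PhiH n HC \<and> (j,i) \<in> PhiH n HC}"
  then obtain i j where hij: "h = unitE (2*n) i i - unitE (2*n) j j"
    and ij: "(i,j) \<in> PhiH n HC" "(j,i) \<in> PhiH n HC" by blast
  have *: "(k,l) \<in> PhiH n HC" if ij: "(i,j) \<in> PhiH n HC" "(j,i) \<in> PhiH n HC" and m: "k = i \<or> l = i" for i j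
  proof -
    note b = PhiH_D[OF ij(1)]
    consider "k = i" "l = j" | "k = i" "l \<noteq> j" | "l = i" "k = j" | "l = i" "k \<noteq> j" using m by blast
    then show ?thesis
    proof cases
      case 2
      then have "(j,l) \<in> PhiH n HC" using PhiH_right[OF ij(2), of l] kl by auto
      then show ?thesis using PhiH_trans[OF ij(1), of l] 2 kl by simp
    next
      case 4
      then have "(k,j) \<in> PhiH n HC" using PhiH_left[OF ij(1), of k] kl by auto
      then show ?thesis using PhiH_trans[OF _ ij(2), of k] 4 kl by simp
    qed (use ij in simp_all)
  qed
  have "k = i \<or> l = i \<or> k = j \<or> l = j"
    using ne kl unfolding hij by (auto split: if_splits)
  then show ?thesis using *[OF ij] *[OF ij(2,1)] by blast
qed

text \<open>The critical case is the bracket of E_kl with E_lk for k < l. It equals E_kk - E_ll,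
  which lies in \<open>HfromC\<close> because \<open>PhiH_opposite\<close> supplies (k,l) besides
  (l,k).\<close>

lemma unitE_bracket_HfromC:
  assumes kl: "k \<le> l" "l < 2*n" and y: "y \<in> cartan_gens \<union> root_gens"
  shows "bracket (unitE (2*n) k l) y \<in> HfromC n HC"
  using y
proof
  assume y: "y \<in> cartan_gens"
  note d = cartan_gens_diagonal[OF y]
  have k: "k < 2*n" using kl by simp
  show ?thesis
  proof (cases "y $$ (l,l) = y $$ (k,k)")
    case True
    then have "bracket (unitE (2*n) k l) y = 0\<^sub>m (2*n) (2*n)"
      using bracket_unitE_diagonal[of y "2*n" k l] d k kl by (auto intro!: eq_matI)
    then show ?thesis using msubspace_zero[OF HfromC_subspace] by simp
  next
    case False
    then have "(k,l) \<in> PhiH n HC" using cartan_gens_PhiH[OF y, of k l] kl by (cases "k = l") auto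
    then show ?thesis using bracket_unitE_diagonal[of y "2*n" k l] d k kl
      by (auto intro!: msubspace_smult[OF HfromC_subspace] HfromC_root)
  qed
next
  assume "y \<in> root_gens"
  then obtain i j where y: "y = unitE (2*n) i j" and ij: "(i,j) \<in> PhiH n HC" by blast
  note b = PhiH_D[OF ij]
  have k: "k < 2*n" using kl by simp
  note br = bracket_unitE_unitE[OF k kl(2) b(1,2), folded y]
  note S = msubspace_minus[OF HfromC_subspace] and Z = msubspace_zero[OF HfromC_subspace]
  show ?thesis
  proof (cases "k = l")
    case True
    then show ?thesis unfolding br using ij b by (auto intro!: S Z HfromC_root)
  next
    case False
    then have kl': "k < l" using kl by simp
    consider "l = i" "j = k" | "l = i" "j \<noteq> k" | "l \<noteq> i" "j = k" | "l \<noteq> i" "j \<noteq> k" by blast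
    then show ?thesis
    proof cases
      case 1
      then have "(k,l) \<in> PhiH n HC" "(l,k) \<in> PhiH n HC" using ij PhiH_opposite[OF ij] kl' by auto
      then show ?thesis unfolding br using 1 by (simp add: HfromC_diff)
    next
      case 2
      then have "(k,j) \<in> PhiH n HC" using PhiH_left[OF ij, of k] kl' by simp
      then show ?thesis unfolding br using 2 by (auto intro!: S Z HfromC_root)
    next
      case 3
      then have "(i,l) \<in> PhiH n HC" using PhiH_right[OF ij, of l] kl' kl by simp
      then show ?thesis unfolding br using 3 by (auto intro!: S Z HfromC_root)
    next
      case 4
      then show ?thesis unfolding br by (auto intro!: S Z)
    qed
  qed
qed

text \<open>Expanding \<open>b\<close> into matrix units leaves \<open>sl\<close>, since a diagonal
  unit has trace 1; so the claim is made for all upper triangular matrices.\<close>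

lemma upper_bracket_HfromC:
  assumes b: "b \<in> carrier_mat (2*n) (2*n)" "upper_triangular b" and y: "y \<in> HfromC n HC"
  shows "bracket b y \<in> HfromC n HC"
proof -
  let ?H = "HfromC n HC"
  note sub = is_msubspace_bracket[OF HfromC_subspace]
  have E: "bracket (unitE (2*n) k l) y \<in> ?H" if "k \<le> l" "l < 2*n" for k l
  proof -
    have "?H \<subseteq> {z \<in> carrier_mat (2*n) (2*n). bracket (unitE (2*n) k l) z \<in> ?H}"
    proof (rule HfromC_least[OF sub(2)[OF unitE_carrier]])
      show "cartan_gens \<subseteq> {z \<in> carrier_mat (2*n) (2*n). bracket (unitE (2*n) k l) z \<in> ?H}"
        using unitE_bracket_HfromC[OF that] gens_carrier(1) by (intro subsetI CollectI conjI UnI1) auto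
      show "root_gens \<subseteq> {z \<in> carrier_mat (2*n) (2*n). bracket (unitE (2*n) k l) z \<in> ?H}"
        using unitE_bracket_HfromC[OF that] gens_carrier(2) by (intro subsetI CollectI conjI UnI2) auto
    qed
    then show ?thesis using y by blast
  qed
  have yc: "y \<in> carrier_mat (2*n) (2*n)" using msubspace_carrier[OF HfromC_subspace y] .
  have "b \<in> {b \<in> carrier_mat (2*n) (2*n). bracket b y \<in> ?H}"
  proof (rule mat_in_msubspaceI[OF sub(1)[OF yc] b(1)])
    fix k l assume kl: "k < 2*n" "l < 2*n" "b $$ (k,l) \<noteq> 0"
    then have "k \<le> l" using upper_triangularD[OF b(2), of l k] b(1) by (cases "l < k") auto
    then show "unitE (2*n) k l \<in> {b \<in> carrier_mat (2*n) (2*n). bracket b y \<in> ?H}"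
      using E kl by simp
  qed
  then show ?thesis by simp
qed

lemma HfromC_sl: "HfromC n HC \<subseteq> sl n"
proof (rule HfromC_least[OF is_msubspace_sl])
  have "unitE (2*n) i i - unitE (2*n) j j \<in> sl n" if "i < 2*n" "j < 2*n" for i j
    using that minus_carrier_mat[OF unitE_carrier[of "2*n" j j], of "unitE (2*n) i i"]
    by (simp add: sl_def mtrace_def sum_subtractf)
  then show "cartan_gens \<subseteq> sl n"
    using HC_gC PhiH_D by (auto simp: gC_def)
  show "root_gens \<subseteq> sl n"
    using PhiH_D by (auto simp: sl_def mtrace_def intro!: sum.neutral)
qed

lemma hessA_HfromC: "hessA n (HfromC n HC)"
  unfolding hessA_def
  using HfromC_subspace HfromC_sl upper_bracket_HfromC by (auto simp: bor_def sl_def)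

text \<open>Linear in \<open>y\<close>, so generators suffice: E_ij gives \<open>root_vec\<close>,
  h_ij gives a coroot, and h in \<open>HC\<close> gives 2h. The coroot is in \<open>HC\<close>
  because one of (i,j), (j,i) is a negative root.\<close>

lemma HfromC_sym_HC:
  assumes "y \<in> HfromC n HC"
  shows "y + sigma_alg n y \<in> HC"
proof -
  note sub = HC_subspace
  let ?V = "{y \<in> carrier_mat (2*n) (2*n). y + sigma_alg n y \<in> HC}"
  have "HfromC n HC \<subseteq> ?V"
  proof (rule HfromC_least)
    show "is_msubspace (2*n) ?V" unfolding is_msubspace_def
    proof (intro conjI ballI allI)
      have "0\<^sub>m (2*n) (2*n) + sigma_alg n (0\<^sub>m (2*n) (2*n)) = 0\<^sub>m (2*n) (2*n)"
        by (intro eq_matI) (simp_all add: sigma_alg_index)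
      then show "0\<^sub>m (2*n) (2*n) \<in> ?V" using msubspace_zero[OF sub] by simp
    next
      fix x y assume xy: "x \<in> ?V" "y \<in> ?V"
      then have "x + y + sigma_alg n (x + y) = (x + sigma_alg n x) + (y + sigma_alg n y)"
        by (intro eq_matI) (auto simp: sigma_alg_add)
      then show "x + y \<in> ?V" using xy msubspace_add[OF sub] by auto
    next
      fix c x assume x: "x \<in> ?V"
      then have "c \<cdot>\<^sub>m x + sigma_alg n (c \<cdot>\<^sub>m x) = c \<cdot>\<^sub>m (x + sigma_alg n x)"
        by (intro eq_matI) (auto simp: sigma_alg_smult distrib_left)
      then show "c \<cdot>\<^sub>m x \<in> ?V" using x msubspace_smult[OF sub] by auto
    qed auto
    show "root_gens \<subseteq> ?V" using PhiH_D by (auto simp: root_vec_def)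
    have d: "unitE (2*n) i i - unitE (2*n) j j \<in> ?V" if ij: "(i,j) \<in> PhiH n HC" "(j,i) \<in> PhiH n HC" for i j
    proof -
      note b = PhiH_D[OF ij(1)]
      have "sigma_alg n (unitE (2*n) i i + (-1) \<cdot>\<^sub>m unitE (2*n) j j)
          = (-1) \<cdot>\<^sub>m unitE (2*n) (mirror n i) (mirror n i) + unitE (2*n) (mirror n j) (mirror n j)"
        using b by (auto simp: sigma_alg_add sigma_alg_smult sigma_unitE intro!: eq_matI)
      moreover have "unitE (2*n) i i - unitE (2*n) j j = unitE (2*n) i i + (-1) \<cdot>\<^sub>m unitE (2*n) j j"
        by (intro eq_matI) auto
      ultimately have "unitE (2*n) i i - unitE (2*n) j j + sigma_alg n (unitE (2*n) i i - unitE (2*n) j j)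
        = coroot i j"
        by (intro eq_matI) auto
      moreover have "\<dots> \<in> HC"
        using coroot_HC(1)[OF ij(1)] coroot_HC(2)[OF ij(2)] b(3) by (cases "j < i") auto
      ultimately show ?thesis using minus_carrier_mat[OF unitE_carrier[of "2*n" j j], of "unitE (2*n) i i"] by simp
    qed
    have h: "h \<in> ?V" if "h \<in> HC" for h
    proof -
      have "sigma_alg n h = h" using HC_gC[OF that] by (simp add: gC_def)
      then show ?thesis using that HC_carrier[OF that] msubspace_add[OF sub] by simp
    qed
    show "cartan_gens \<subseteq> ?V" using d h by blast
  qed
  then show ?thesis using assms by blast
qed

lemma HC_sub_HfromC:
  assumes x: "x \<in> HC"
  shows "x \<in> HfromC n HC"
proof -
  note xc = HC_carrier[OF x]
  \<comment> \<open>Odd under mirroring and injective, so its weight 0 part is exactly the diagonal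
    of \<open>x\<close>.\<close>
  let ?f = "\<lambda>a. 2 * of_nat n - 1 - 2 * of_nat a :: complex"
  let ?D = "mat (2*n) (2*n) (\<lambda>(a,b). if ?f a - ?f b = 0 then x $$ (a,b) else 0)"
  have D: "?D \<in> HC"
    using x by (intro HC_weight_component) (auto simp: mirror_def of_nat_diff)
  have Deq: "?D = diag_fun (2*n) (\<lambda>a. x $$ (a,a))" by (intro eq_matI) auto
  have "?D \<in> hsig n" unfolding Deq
  proof (rule diag_fun_in_hsig)
    fix a assume "a < 2*n"
    then show "x $$ (mirror n a, mirror n a) = - x $$ (a,a)"
      using gC_index[OF HC_gC[OF x], of a a] by simp
  qed
  then have DH: "?D \<in> HfromC n HC" using D by (intro HfromC_cartan)
  have "x - ?D \<in> HfromC n HC"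
  proof (rule mat_in_msubspaceI[OF HfromC_subspace])
    fix a b assume ab: "a < 2*n" "b < 2*n" "(x - ?D) $$ (a,b) \<noteq> 0"
    then have "a \<noteq> b" "x $$ (a,b) \<noteq> 0" unfolding Deq using xc by (auto split: if_splits)
    then show "unitE (2*n) a b \<in> HfromC n HC"
      using PhiH_I[OF x] ab by (intro HfromC_root) blast
  qed (use xc in auto)
  then have "?D + (x - ?D) \<in> HfromC n HC" by (rule msubspace_add[OF HfromC_subspace DH])
  moreover have "?D + (x - ?D) = x" using xc by (intro eq_matI) auto
  ultimately show ?thesis by simp
qed

lemma HfromC_fixed: "{y \<in> HfromC n HC. sigma_alg n y = y} = HC"
proof (intro Set.equalityI Set.subsetI)
  fix y assume "y \<in> {y \<in> HfromC n HC. sigma_alg n y = y}"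
  then have y: "y \<in> HfromC n HC" "sigma_alg n y = y" by auto
  have "y + y \<in> HC" using HfromC_sym_HC[OF y(1)] y(2) by simp
  then have "(1/2) \<cdot>\<^sub>m (y + y) \<in> HC" by (rule msubspace_smult[OF HC_subspace])
  moreover have "(1/2) \<cdot>\<^sub>m (y + y) = y" by (intro eq_matI) auto
  ultimately show "y \<in> HC" by simp
next
  fix y assume "y \<in> HC"
  then show "y \<in> {y \<in> HfromC n HC. sigma_alg n y = y}"
    using HC_sub_HfromC HC_gC by (simp add: gC_def)
qed

section \<open>Invariance under triangular conjugation\<close>

lemma diag_fun_conj_HfromC:
  assumes fg: "\<And>a. a < 2*n \<Longrightarrow> f a * g a = 1" and y: "y \<in> HfromC n HC"
  shows "diag_fun (2*n) f * y * diag_fun (2*n) g \<in> HfromC n HC"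
proof -
  let ?V = "{y \<in> carrier_mat (2*n) (2*n). diag_fun (2*n) f * y * diag_fun (2*n) g \<in> HfromC n HC}"
  have "HfromC n HC \<subseteq> ?V"
  proof (rule HfromC_least[OF is_msubspace_conj[OF HfromC_subspace diag_fun_carrier diag_fun_carrier]])
    show "cartan_gens \<subseteq> ?V"
    proof
      fix h assume h: "h \<in> cartan_gens"
      note d = cartan_gens_diagonal[OF h]
      have "diag_fun (2*n) f * h * diag_fun (2*n) g = h"
      proof (rule eq_matI)
        fix a b assume "a < dim_row h" "b < dim_col h"
        then show "(diag_fun (2*n) f * h * diag_fun (2*n) g) $$ (a,b) = h $$ (a,b)"
          using d fg[of a] by (cases "a = b") (auto simp: diag_fun_conj_index diagonal_mat_def simp del: index_mult_mat(1))
      qed (use d in auto)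
      moreover have "h \<in> HfromC n HC" unfolding HfromC_eq using h by (intro mspan.gen) blast
      ultimately show "h \<in> ?V" using d by simp
    qed
    show "root_gens \<subseteq> ?V"
    proof
      fix e assume "e \<in> root_gens"
      then obtain i j where e: "e = unitE (2*n) i j" and ij: "(i,j) \<in> PhiH n HC" by blast
      have "diag_fun (2*n) f * e * diag_fun (2*n) g = (f i * g j) \<cdot>\<^sub>m e"
        unfolding e by (intro eq_matI) (auto simp: diag_fun_conj_index simp del: index_mult_mat(1))
      then show "e \<in> ?V" using HfromC_root[OF ij] msubspace_smult[OF HfromC_subspace] e by simp
    qed
  qed
  then show ?thesis using y by blast
qed

text \<open>Passes from bracket stability to the group without exponentials. Each one-row factor of
  \<open>c\<close> is (1 + v) D with \<open>D\<close> diagonal. \<open>v\<close> lives in row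
  \<open>k\<close> off the diagonal, so \<open>v\<close> squares to zero and
  \<open>conj_square_zero\<close> expresses its conjugation by brackets.\<close>

lemma upper_conj_HfromC:
  assumes c: "c \<in> carrier_mat (2*n) (2*n)" "upper_triangular c" and nz: "det c \<noteq> 0"
    and y: "y \<in> HfromC n HC"
  shows "c * y * minv c \<in> HfromC n HC"
proof -
  let ?H = "HfromC n HC" and ?N = "2*n"
  note sub = HfromC_subspace
  \<comment> \<open>The inverse is carried along explicitly, so that the induction never has to
    compute \<open>minv\<close> of a partial product.\<close>
  define P where "P X \<longleftrightarrow> (\<exists>X'. X' \<in> carrier_mat ?N ?N \<and> X * X' = 1\<^sub>m ?N \<and> (\<forall>y\<in>?H. X * y * X' \<in> ?H))" for X
  have "P c"
  proof (rule upper_triangular_row_induct[OF c])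
    have "1\<^sub>m ?N * y * 1\<^sub>m ?N \<in> ?H" if "y \<in> ?H" for y
      using that msubspace_carrier[OF sub that] by simp
    then show "P (1\<^sub>m ?N)" unfolding P_def by (intro exI[of _ "1\<^sub>m ?N"]) simp
  next
    fix X k assume X: "X \<in> carrier_mat ?N ?N" and k: "k < ?N" and "P X"
    then obtain X' where X': "X' \<in> carrier_mat ?N ?N" "X * X' = 1\<^sub>m ?N" "\<And>y. y \<in> ?H \<Longrightarrow> X * y * X' \<in> ?H"
      unfolding P_def by blast
    let ?R = "mat ?N ?N (\<lambda>(a,b). if a = k then c $$ (k,b) else if a = b then 1 else 0)"
    define v where "v = mat ?N ?N (\<lambda>(a,b). if a = k \<and> b \<noteq> k then c $$ (k,b) else 0)"
    define D where "D = diag_fun ?N (\<lambda>a. if a = k then c $$ (k,k) else 1)"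
    define D' where "D' = diag_fun ?N (\<lambda>a. if a = k then 1 / c $$ (k,k) else 1)"
    have ckk: "c $$ (k,k) \<noteq> 0" using upper_triangular_diag_nz[OF c nz k] .
    have vc: "v \<in> carrier_mat ?N ?N" by (simp add: v_def)
    have Dc: "D \<in> carrier_mat ?N ?N" "D' \<in> carrier_mat ?N ?N" by (simp_all add: D_def D'_def)
    have vv: "v * v = 0\<^sub>m ?N ?N"
    proof (rule eq_matI)
      fix a b assume ab: "a < dim_row (0\<^sub>m ?N ?N)" "b < dim_col (0\<^sub>m ?N ?N)"
      then have "(v * v) $$ (a,b) = (\<Sum>m<?N. v $$ (a,m) * v $$ (m,b))"
        using vc by (subst index_mult_sum) auto
      also have "\<dots> = 0" using ab by (intro sum.neutral) (auto simp: v_def)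
      finally show "(v * v) $$ (a,b) = 0\<^sub>m ?N ?N $$ (a,b)" using ab by simp
    qed (use vc in simp_all)
    have vu: "upper_triangular v"
      using upper_triangularD[OF c(2), of _ k] c(1) by (auto simp: v_def upper_triangular_def)
    have DD: "D * D' = 1\<^sub>m ?N"
    proof (rule eq_matI)
      fix a b assume ab: "a < dim_row (1\<^sub>m ?N)" "b < dim_col (1\<^sub>m ?N)"
      have "D * D' = D * 1\<^sub>m ?N * D'" using Dc by simp
      then show "(D * D') $$ (a,b) = 1\<^sub>m ?N $$ (a,b)"
        using ab ckk diag_fun_conj_index[of "1\<^sub>m ?N" ?N a b] unfolding D_def D'_def by simp
    qed (use Dc in simp_all)
    \<comment> \<open>\<open>D\<close> stands on the right because it then scales only column
      \<open>k\<close>, where \<open>v\<close> is zero.\<close>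
    have R: "?R = (1\<^sub>m ?N + v) * D"
    proof (rule eq_matI)
      fix a b assume "a < dim_row ((1\<^sub>m ?N + v) * D)" "b < dim_col ((1\<^sub>m ?N + v) * D)"
      then have ab: "a < ?N" "b < ?N" using vc Dc by simp_all
      have "(1\<^sub>m ?N + v) * D = diag_fun ?N (\<lambda>_. 1) * (1\<^sub>m ?N + v) * D"
      proof -
        have "diag_fun ?N (\<lambda>_. 1) = 1\<^sub>m ?N" by (intro eq_matI) auto
        then show ?thesis using vc by simp
      qed
      then show "?R $$ (a,b) = ((1\<^sub>m ?N + v) * D) $$ (a,b)"
        using ab k diag_fun_conj_index[of "1\<^sub>m ?N + v" ?N a b] vc unfolding D_def by (simp add: v_def)
    qed (use vc Dc in simp_all)
    have uc: "1\<^sub>m ?N + v \<in> carrier_mat ?N ?N" "1\<^sub>m ?N - v \<in> carrier_mat ?N ?N" using vc by auto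
    have uu: "(1\<^sub>m ?N + v) * (1\<^sub>m ?N - v) = 1\<^sub>m ?N"
    proof -
      have "bracket v (1\<^sub>m ?N) = 0\<^sub>m ?N ?N" "bracket v (0\<^sub>m ?N ?N) = 0\<^sub>m ?N ?N"
        using vc unfolding bracket_def by (auto intro!: eq_matI)
      then show ?thesis
        using conj_square_zero[OF vc vv one_carrier_mat] unfolding right_mult_one_mat[OF uc(1)] by simp
    qed
    note as = assoc_mult_mat[of _ ?N ?N _ ?N _ ?N]
    show "P (X * ?R)" unfolding P_def R
    proof (intro exI[of _ "D' * (1\<^sub>m ?N - v) * X'"] conjI ballI)
      show "D' * (1\<^sub>m ?N - v) * X' \<in> carrier_mat ?N ?N" using uc Dc X' by simp
      have "X * ((1\<^sub>m ?N + v) * D) * (D' * (1\<^sub>m ?N - v) * X') = X * ((1\<^sub>m ?N + v) * ((D * D') * ((1\<^sub>m ?N - v) * X')))"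
        using X X' uc Dc by (simp add: as)
      also have "\<dots> = X * (((1\<^sub>m ?N + v) * (1\<^sub>m ?N - v)) * X')" unfolding DD
        using X X' uc by (simp add: as left_mult_one_mat[OF mult_carrier_mat[OF uc(2) X'(1)]])
      also have "\<dots> = 1\<^sub>m ?N" unfolding uu using X' by simp
      finally show "X * ((1\<^sub>m ?N + v) * D) * (D' * (1\<^sub>m ?N - v) * X') = 1\<^sub>m ?N" .
    next
      fix y assume y: "y \<in> ?H"
      let ?z = "D * y * D'"
      have z: "?z \<in> ?H" unfolding D_def D'_def by (rule diag_fun_conj_HfromC[OF _ y]) (use ckk in auto)
      note zc = msubspace_carrier[OF sub z] and yc = msubspace_carrier[OF sub y]
      have b1: "bracket v ?z \<in> ?H" using upper_bracket_HfromC[OF vc vu z] .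
      have b2: "bracket v (bracket v ?z) \<in> ?H" using upper_bracket_HfromC[OF vc vu b1] .
      have "(1\<^sub>m ?N + v) * ?z * (1\<^sub>m ?N - v) \<in> ?H"
        unfolding conj_square_zero[OF vc vv zc]
        by (intro msubspace_add[OF sub] msubspace_smult[OF sub] z b1 b2)
      from X'(3)[OF this] have "X * ((1\<^sub>m ?N + v) * ?z * (1\<^sub>m ?N - v)) * X' \<in> ?H" .
      moreover have "X * ((1\<^sub>m ?N + v) * D) * y * (D' * (1\<^sub>m ?N - v) * X')
          = X * ((1\<^sub>m ?N + v) * ?z * (1\<^sub>m ?N - v)) * X'"
        using X X' uc Dc yc by (simp add: as)
      ultimately show "X * ((1\<^sub>m ?N + v) * D) * y * (D' * (1\<^sub>m ?N - v) * X') \<in> ?H" by simp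
    qed
  qed
  then obtain X' where X': "X' \<in> carrier_mat ?N ?N" "c * X' = 1\<^sub>m ?N" "\<forall>y\<in>?H. c * y * X' \<in> ?H"
    unfolding P_def by blast
  then show ?thesis using minv_unique[OF c(1) X'(1,2)] y by simp
qed

end

section \<open>Symplectic matrices have determinant one\<close>

lemma prod_pairs:
  fixes h :: "nat \<Rightarrow> 'a :: comm_monoid_mult"
  shows "(\<Prod>i<2*n. h i) = (\<Prod>i<n. h i * h (mirror n i))"
proof -
  have "(\<Prod>i<2*n. h i) = (\<Prod>i\<in>{..<n} \<union> {n..<2*n}. h i)"
    by (rule arg_cong[of _ _ "prod h"]) auto
  also have "\<dots> = (\<Prod>i<n. h i) * (\<Prod>i=n..<2*n. h i)"
    by (rule prod.union_disjoint) auto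
  also have "(\<Prod>i=n..<2*n. h i) = (\<Prod>i<n. h (mirror n i))"
    by (rule prod.reindex_bij_witness[of _ "mirror n" "mirror n"]) (auto simp: mirror_def)
  finally show ?thesis by (simp add: prod.distrib)
qed

text \<open>The symplectic form of rows \<open>u\<close> and \<open>v\<close> of \<open>g\<close>,
  reindexed so that the sign belongs to the column taken from row \<open>u\<close>.\<close>

lemma form_index:
  assumes g: "g \<in> carrier_mat (2*n) (2*n)" and uv: "u < 2*n" "v < 2*n"
  shows "(g * Emat n * transpose_mat g) $$ (u,v) = (\<Sum>a<2*n. esign n a * (g $$ (u,a) * g $$ (v, mirror n a)))"
proof -
  have "(g * Emat n * transpose_mat g) $$ (u,v) = (\<Sum>b<2*n. (g * Emat n) $$ (u,b) * g $$ (v,b))"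
    using g uv by (subst index_mult_sum) auto
  also have "\<dots> = (\<Sum>b<2*n. - esign n b * (g $$ (u, mirror n b) * g $$ (v,b)))"
    using g uv by (intro sum.cong refl) (simp add: Emat_mult_right[OF g] del: index_mult_mat(1))
  also have "\<dots> = (\<Sum>a<2*n. - esign n (mirror n a) * (g $$ (u, mirror n (mirror n a)) * g $$ (v, mirror n a)))"
    by (rule sum_mirror[symmetric])
  also have "\<dots> = (\<Sum>a<2*n. esign n a * (g $$ (u,a) * g $$ (v, mirror n a)))"
    by (intro sum.cong) auto
  finally show ?thesis .
qed

text \<open>\<open>n! 2\<^sup>n\<close> times the Pfaffian.\<close>

definition pfaff :: "nat \<Rightarrow> complex mat \<Rightarrow> complex" where
  "pfaff n M = (\<Sum>p | p permutes {0..<2*n}. signof p * (\<Prod>i<n. M $$ (p i, p (mirror n i))))"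

text \<open>Expanding the form entry of the pair (i,i') picks a column \<open>f i\<close> for the
  row of i, and its mirror for the row of i'; this records both choices.\<close>

definition pair_ext :: "nat \<Rightarrow> (nat \<Rightarrow> nat) \<Rightarrow> nat \<Rightarrow> nat" where
  "pair_ext n f i = (if i < n then f i else mirror n (f (mirror n i)))"

text \<open>Right multiplication by it makes column \<open>f j\<close> the new column
  \<open>j\<close>.\<close>

definition select_mat :: "nat \<Rightarrow> (nat \<Rightarrow> nat) \<Rightarrow> complex mat" where
  "select_mat N f = mat N N (\<lambda>(i,j). if i = f j then 1 else 0)"

lemma select_mat_carrier [simp]: "select_mat N f \<in> carrier_mat N N"
  and select_mat_dim [simp]: "dim_row (select_mat N f) = N" "dim_col (select_mat N f) = N"
  and select_mat_index: "i < N \<Longrightarrow> j < N \<Longrightarrow> select_mat N f $$ (i,j) = (if i = f j then 1 else 0)"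
  by (simp_all add: select_mat_def)

text \<open>The factor of the expansion belonging to the choice \<open>f\<close> that is independent
  of g.\<close>

definition pfaff_term :: "nat \<Rightarrow> (nat \<Rightarrow> nat) \<Rightarrow> complex" where
  "pfaff_term n f = (\<Prod>i<n. esign n (f i)) * det (select_mat (2*n) (pair_ext n f))"

lemma pair_ext_less: "(\<And>i. i < n \<Longrightarrow> f i < 2*n) \<Longrightarrow> i < 2*n \<Longrightarrow> pair_ext n f i < 2*n"
  by (auto simp: pair_ext_def intro!: mirror_less) (auto simp: mirror_def)

lemma mult_select_mat_index:
  assumes "g \<in> carrier_mat N N" "i < N" "j < N" "f j < N"
  shows "(g * select_mat N f) $$ (i,j) = g $$ (i, f j)"
proof -
  have "(g * select_mat N f) $$ (i,j) = (\<Sum>k<N. g $$ (i,k) * select_mat N f $$ (k,j))"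
    using assms by (subst index_mult_sum) auto
  also have "\<dots> = g $$ (i,f j) * select_mat N f $$ (f j,j)"
    using assms by (intro sum_eq_single) (auto simp: select_mat_index)
  finally show ?thesis using assms by (simp add: select_mat_index)
qed

text \<open>Expand every form entry, exchange the sums over \<open>p\<close> and \<open>f\<close>,
  and read the inner sum as the determinant of \<open>g\<close> with selected columns. The remaining
  factor is the same for all \<open>g\<close>, and only its being nonzero is needed later.\<close>

lemma pfaff_congruence:
  assumes g: "g \<in> carrier_mat (2*n) (2*n)"
  shows "pfaff n (g * Emat n * transpose_mat g) = det g * (\<Sum>f \<in> PiE {..<n} (\<lambda>_. {..<2*n}). pfaff_term n f)"
proof -
  let ?P = "{p. p permutes {0..<2*n}}" and ?F = "PiE {..<n} (\<lambda>_. {..<2*n})"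
  have step: "(\<Prod>i<n. (g * Emat n * transpose_mat g) $$ (p i, p (mirror n i)))
      = (\<Sum>f\<in>?F. (\<Prod>i<n. esign n (f i)) * (\<Prod>j<2*n. (g * select_mat (2*n) (pair_ext n f)) $$ (p j, j)))"
    if p: "p \<in> ?P" for p
  proof -
    have pl: "p i < 2*n" if "i < 2*n" for i using p that permutes_in_image[of p "{0..<2*n}" i] by auto
    have "(\<Prod>i<n. (g * Emat n * transpose_mat g) $$ (p i, p (mirror n i)))
       = (\<Prod>i<n. \<Sum>a<2*n. esign n a * (g $$ (p i,a) * g $$ (p (mirror n i), mirror n a)))"
      by (intro prod.cong refl form_index[OF g] pl) auto
    also have "\<dots> = (\<Sum>f\<in>?F. \<Prod>i<n. esign n (f i) * (g $$ (p i,f i) * g $$ (p (mirror n i), mirror n (f i))))"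
      by (rule prod_sum_PiE) auto
    also have "\<dots> = (\<Sum>f\<in>?F. (\<Prod>i<n. esign n (f i)) * (\<Prod>j<2*n. (g * select_mat (2*n) (pair_ext n f)) $$ (p j, j)))"
    proof (rule sum.cong[OF refl])
      fix f assume "f \<in> ?F"
      then have f: "\<And>i. i < n \<Longrightarrow> f i < 2*n" by auto
      have "(\<Prod>j<2*n. (g * select_mat (2*n) (pair_ext n f)) $$ (p j, j)) = (\<Prod>j<2*n. g $$ (p j, pair_ext n f j))"
        by (intro prod.cong refl mult_select_mat_index[OF g] pl pair_ext_less f) auto
      also have "\<dots> = (\<Prod>i<n. g $$ (p i, pair_ext n f i) * g $$ (p (mirror n i), pair_ext n f (mirror n i)))"
        by (rule prod_pairs)
      also have "\<dots> = (\<Prod>i<n. g $$ (p i,f i) * g $$ (p (mirror n i), mirror n (f i)))"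
      proof (rule prod.cong[OF refl])
        fix i assume "i \<in> {..<n}"
        then have "pair_ext n f i = f i" "pair_ext n f (mirror n i) = mirror n (f i)"
          by (auto simp: pair_ext_def) (auto simp: mirror_def)
        then show "g $$ (p i, pair_ext n f i) * g $$ (p (mirror n i), pair_ext n f (mirror n i)) = g $$ (p i,f i) * g $$ (p (mirror n i), mirror n (f i))"
          by simp
      qed
      finally show "(\<Prod>i<n. esign n (f i) * (g $$ (p i,f i) * g $$ (p (mirror n i), mirror n (f i))))
          = (\<Prod>i<n. esign n (f i)) * (\<Prod>j<2*n. (g * select_mat (2*n) (pair_ext n f)) $$ (p j, j))"
        by (simp add: prod.distrib)
    qed
    finally show ?thesis .
  qed
  have "pfaff n (g * Emat n * transpose_mat g)
      = (\<Sum>p\<in>?P. \<Sum>f\<in>?F. (\<Prod>i<n. esign n (f i)) * (signof p * (\<Prod>j<2*n. (g * select_mat (2*n) (pair_ext n f)) $$ (p j, j))))"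
    unfolding pfaff_def by (intro sum.cong refl, subst step) (simp_all add: sum_distrib_left mult.left_commute)
  also have "\<dots> = (\<Sum>f\<in>?F. (\<Prod>i<n. esign n (f i)) * (\<Sum>p\<in>?P. signof p * (\<Prod>j<2*n. (g * select_mat (2*n) (pair_ext n f)) $$ (p j, j))))"
    by (subst sum.swap) (simp add: sum_distrib_left)
  also have "\<dots> = (\<Sum>f\<in>?F. (\<Prod>i<n. esign n (f i)) * det (g * select_mat (2*n) (pair_ext n f)))"
    by (intro sum.cong refl, subst det_col[of _ "2*n"]) (use g in auto)
  also have "\<dots> = det g * (\<Sum>f\<in>?F. pfaff_term n f)"
    unfolding sum_distrib_left pfaff_term_def
    by (intro sum.cong refl, subst det_mult[OF g]) auto
  finally show ?thesis .
qed

text \<open>Two signs cancel: mirroring \<open>f i\<close> changes one \<open>esign\<close>, and it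
  swaps the columns \<open>i\<close> and \<open>mirror n i\<close> of the selection matrix.\<close>

lemma pfaff_term_flip:
  assumes i: "i < n" and f: "f i < 2*n"
  shows "pfaff_term n (f(i := mirror n (f i))) = pfaff_term n f"
proof -
  let ?f = "f(i := mirror n (f i))"
  have i2: "i < 2*n" using i by simp
  have "pair_ext n ?f i = pair_ext n f (mirror n i)" "pair_ext n ?f (mirror n i) = pair_ext n f i"
    using i f by (auto simp: pair_ext_def) (auto simp: mirror_def)
  moreover have "pair_ext n ?f j = pair_ext n f j" if "j < 2*n" "j \<noteq> i" "j \<noteq> mirror n i" for j
  proof -
    have "mirror n j \<noteq> i" using that i2 mirror_swap[of j n i] by auto
    then show ?thesis using that by (simp add: pair_ext_def)
  qed
  ultimately have e: "pair_ext n ?f j = (if i = j then pair_ext n f (mirror n i) else if mirror n i = j then pair_ext n f i else pair_ext n f j)"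
    if "j < 2*n" for j using that by metis
  have "select_mat (2*n) (pair_ext n ?f) = swapcols i (mirror n i) (select_mat (2*n) (pair_ext n f))"
  proof (rule eq_matI)
    fix a j assume "a < dim_row (swapcols i (mirror n i) (select_mat (2*n) (pair_ext n f)))"
      "j < dim_col (swapcols i (mirror n i) (select_mat (2*n) (pair_ext n f)))"
    then have aj: "a < 2*n" "j < 2*n" by simp_all
    show "select_mat (2*n) (pair_ext n ?f) $$ (a,j) = swapcols i (mirror n i) (select_mat (2*n) (pair_ext n f)) $$ (a,j)"
      unfolding select_mat_index[OF aj] e[OF aj(2)] using aj i2 by (simp add: select_mat_index)
  qed simp_all
  then have "det (select_mat (2*n) (pair_ext n ?f)) = - det (select_mat (2*n) (pair_ext n f))"
    using i2 by (simp add: det_swapcols[of _ "2*n"])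
  moreover have "(\<Prod>j<n. esign n (?f j)) = - (\<Prod>j<n. esign n (f j))"
  proof -
    have "(\<Prod>j<n. esign n (?f j)) = esign n (?f i) * (\<Prod>j\<in>{..<n} - {i}. esign n (?f j))"
      using i by (intro prod.remove) auto
    also have "\<dots> = - (esign n (f i) * (\<Prod>j\<in>{..<n} - {i}. esign n (f j)))" using f by simp
    also have "esign n (f i) * (\<Prod>j\<in>{..<n} - {i}. esign n (f j)) = (\<Prod>j<n. esign n (f j))"
      using i by (intro prod.remove[symmetric]) auto
    finally show ?thesis .
  qed
  ultimately show ?thesis by (simp add: pfaff_term_def)
qed

text \<open>Flips, one at a time, the pairs whose chosen column lies in the second half.\<close>

lemma pfaff_term_fold:
  assumes f: "\<And>i. i < n \<Longrightarrow> f i < 2*n"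
  shows "pfaff_term n f = pfaff_term n (\<lambda>i. if f i < n then f i else mirror n (f i))"
proof -
  have "pfaff_term n f = pfaff_term n (\<lambda>i. if i \<in> S \<and> \<not> f i < n then mirror n (f i) else f i)" (is "_ = pfaff_term n (?h S)")
    if "finite S" "S \<subseteq> {..<n}" for S
    using that
  proof (induction S rule: finite_induct)
    case (insert k S)
    have "pfaff_term n (?h (insert k S)) = pfaff_term n (?h S)"
    proof (cases "f k < n")
      case True
      then have "?h (insert k S) = ?h S" by auto
      then show ?thesis by simp
    next
      case False
      then have "?h (insert k S) = (?h S)(k := mirror n (?h S k))" using insert.hyps by auto
      then show ?thesis using pfaff_term_flip[of k n "?h S"] insert f by auto
    qed
    then show ?case using insert by simp
  qed simp
  from this[of "{..<n}"] have "pfaff_term n f = pfaff_term n (?h {..<n})" by simp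
  also have "\<dots> = pfaff_term n (\<lambda>i. if f i < n then f i else mirror n (f i))"
  proof -
    \<comment> \<open>The two functions may differ from \<open>n\<close> on, but
      \<open>pair_ext\<close> at indices below \<open>2*n\<close> consults only arguments below
      \<open>n\<close>.\<close>
    have "pair_ext n (?h {..<n}) i = pair_ext n (\<lambda>i. if f i < n then f i else mirror n (f i)) i" if "i < 2*n" for i
      using that by (auto simp: pair_ext_def) (auto simp: mirror_def)
    then have "select_mat (2*n) (pair_ext n (?h {..<n})) = select_mat (2*n) (pair_ext n (\<lambda>i. if f i < n then f i else mirror n (f i)))"
      by (intro eq_matI) (simp_all add: select_mat_index)
    moreover have "(\<Prod>i<n. esign n (?h {..<n} i)) = (\<Prod>i<n. esign n (if f i < n then f i else mirror n (f i)))"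
      by (intro prod.cong) auto
    ultimately show ?thesis unfolding pfaff_term_def by (simp only:)
  qed
  finally show ?thesis .
qed

lemma Jmat_sq: "Jmat n * Jmat n = 1\<^sub>m n"
proof (rule eq_matI)
  fix i j assume "i < dim_row (1\<^sub>m n :: complex mat)" "j < dim_col (1\<^sub>m n :: complex mat)"
  then have ij: "i < n" "j < n" by simp_all
  then have "(Jmat n * Jmat n) $$ (i,j) = (\<Sum>k<n. Jmat n $$ (i,k) * Jmat n $$ (k,j))"
    by (subst index_mult_sum) (auto simp: Jmat_def)
  also have "\<dots> = Jmat n $$ (i,n-1-i) * Jmat n $$ (n-1-i,j)"
    using ij by (intro sum_eq_single) (auto simp: Jmat_def)
  finally show "(Jmat n * Jmat n) $$ (i,j) = 1\<^sub>m n $$ (i,j)" using ij by (auto simp: Jmat_def)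
qed (simp_all add: Jmat_def)

lemma Jmat_conj_index:
  assumes Q: "Q \<in> carrier_mat n n" and ij: "i < n" "j < n"
  shows "(Jmat n * Q * Jmat n) $$ (i,j) = Q $$ (n-1-i, n-1-j)"
proof -
  have J: "Jmat n \<in> carrier_mat n n" by (simp add: Jmat_def)
  have "(Jmat n * Q * Jmat n) $$ (i,j) = (\<Sum>k<n. (Jmat n * Q) $$ (i,k) * Jmat n $$ (k,j))"
    using ij Q J by (subst index_mult_sum) auto
  also have "\<dots> = (Jmat n * Q) $$ (i,n-1-j) * Jmat n $$ (n-1-j,j)"
    using ij by (intro sum_eq_single) (auto simp: Jmat_def simp del: index_mult_mat(1))
  also have "(Jmat n * Q) $$ (i,n-1-j) = (\<Sum>k<n. Jmat n $$ (i,k) * Q $$ (k,n-1-j))"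
    using ij Q J by (subst index_mult_sum) auto
  also have "\<dots> = Jmat n $$ (i,n-1-i) * Q $$ (n-1-i,n-1-j)"
    using ij by (intro sum_eq_single) (auto simp: Jmat_def)
  finally show ?thesis using ij by (simp add: Jmat_def)
qed

text \<open>All signs are 1 and the selection matrix is block diagonal with blocks Q and J Q J,
  which have equal determinants since J J = 1.\<close>

lemma pfaff_term_square:
  assumes t: "\<And>i. i < n \<Longrightarrow> t i < n"
  shows "pfaff_term n t = (det (select_mat n t))\<^sup>2"
proof -
  let ?Q = "select_mat n t" and ?J = "Jmat n"
  have J: "?J \<in> carrier_mat n n" by (simp add: Jmat_def)
  have eq: "select_mat (2*n) (pair_ext n t) = four_block_mat ?Q (0\<^sub>m n n) (0\<^sub>m n n) (?J * ?Q * ?J)"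
  proof (rule eq_matI)
    fix i j assume "i < dim_row (four_block_mat ?Q (0\<^sub>m n n) (0\<^sub>m n n) (?J * ?Q * ?J))"
      "j < dim_col (four_block_mat ?Q (0\<^sub>m n n) (0\<^sub>m n n) (?J * ?Q * ?J))"
    then have ij: "i < 2*n" "j < 2*n" using J by simp_all
    show "select_mat (2*n) (pair_ext n t) $$ (i,j) = four_block_mat ?Q (0\<^sub>m n n) (0\<^sub>m n n) (?J * ?Q * ?J) $$ (i,j)"
    proof (cases "j < n")
      case True
      then show ?thesis using ij t[OF True] J by (auto simp: select_mat_index pair_ext_def)
    next
      case False
      define m where "m = mirror n j"
      have m: "m < n" "n - 1 - (j - n) = m" using ij False by (auto simp: m_def mirror_def)
      have e: "pair_ext n t j = mirror n (t m)" using False by (simp add: pair_ext_def m_def)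
      have "n \<le> mirror n (t m)" using t[OF m(1)] by (auto simp: mirror_def)
      moreover have "(i = mirror n (t m)) = (n - 1 - (i - n) = t m)" if "\<not> i < n"
        using that ij t[OF m(1)] by (auto simp: mirror_def)
      ultimately show ?thesis using ij False m e J
        by (auto simp: select_mat_index Jmat_conj_index simp del: index_mult_mat(1))
    qed
  qed (use J in simp_all)
  have "det (?J * ?Q * ?J) = det ?Q * det (?J * ?J)"
    using J by (simp add: det_mult[of _ n])
  also have "\<dots> = det ?Q" by (simp add: Jmat_sq)
  finally have "det (select_mat (2*n) (pair_ext n t)) = det ?Q * det ?Q"
    unfolding eq using J by (subst det_four_block_mat_lower_left_zero[of _ n _ n]) auto
  moreover have "(\<Prod>i<n. esign n (t i)) = 1" using t by (intro prod.neutral) (auto simp: esign_def)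
  ultimately show ?thesis by (simp add: pfaff_term_def power2_eq_square)
qed

text \<open>Makes the squares of these complex determinants nonnegative integers.\<close>

lemma det_select_mat_int: "\<exists>z::int. det (select_mat n t) = of_int z"
proof -
  have "select_mat n t = map_mat of_int (mat n n (\<lambda>(i,j). if i = t j then 1 else 0))"
    by (intro eq_matI) (auto simp: select_mat_index)
  then show ?thesis by (metis of_int_hom.hom_det)
qed

text \<open>Flipping pairs turns each term into the square of an integer determinant, so nothing cancels.\<close>

lemma pfaff_term_sum_nz: "(\<Sum>f \<in> PiE {..<n} (\<lambda>_. {..<2*n}). pfaff_term n f) \<noteq> 0"
proof -
  let ?F = "PiE {..<n} (\<lambda>_. {..<2*n})"
  have "\<exists>z::int. z \<ge> 0 \<and> pfaff_term n f = of_int z" if f: "f \<in> ?F" for f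
  proof -
    let ?t = "\<lambda>i. if f i < n then f i else mirror n (f i)"
    have fl: "f i < 2*n" if "i < n" for i using f that by auto
    obtain z :: int where "det (select_mat n ?t) = of_int z" using det_select_mat_int by blast
    moreover have "pfaff_term n ?t = (det (select_mat n ?t))\<^sup>2"
      by (rule pfaff_term_square) (use fl in \<open>auto simp: mirror_def\<close>)
    ultimately have "pfaff_term n f = of_int (z\<^sup>2)" using pfaff_term_fold[of n f] fl by simp
    then show ?thesis by (metis zero_le_power2)
  qed
  then obtain z :: "(nat \<Rightarrow> nat) \<Rightarrow> int" where z: "\<And>f. f \<in> ?F \<Longrightarrow> z f \<ge> 0 \<and> pfaff_term n f = of_int (z f)"
    by metis
  \<comment> \<open>The identity choice contributes 1, which makes a sum of nonnegative integers
    positive.\<close>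
  let ?id = "restrict (\<lambda>i. i) {..<n}"
  have idF: "?id \<in> ?F" by auto
  have "select_mat n ?id = 1\<^sub>m n" by (intro eq_matI) (auto simp: select_mat_index)
  moreover have "pfaff_term n ?id = (det (select_mat n ?id))\<^sup>2" by (rule pfaff_term_square) simp
  ultimately have "z ?id = 1" using z[OF idF] by simp
  moreover have "finite ?F" by (intro finite_PiE) auto
  ultimately have "0 < (\<Sum>f\<in>?F. z f)"
    using idF z by (intro sum_pos2[of _ ?id]) auto
  moreover have "(\<Sum>f\<in>?F. pfaff_term n f) = of_int (\<Sum>f\<in>?F. z f)" using z by simp
  ultimately show ?thesis by (simp only: of_int_eq_0_iff)
qed

text \<open>Compares \<open>pfaff_congruence\<close> at \<open>g\<close> and at the identity: both
  forms equal E, so det g times a nonzero constant is that constant.\<close>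

lemma det_symplectic:
  assumes g: "g \<in> carrier_mat (2*n) (2*n)" and sp: "g * Emat n * transpose_mat g = Emat n"
  shows "det g = 1"
proof -
  let ?K = "\<Sum>f \<in> PiE {..<n} (\<lambda>_. {..<2*n}). pfaff_term n f"
  have "pfaff n (1\<^sub>m (2*n) * Emat n * transpose_mat (1\<^sub>m (2*n))) = ?K"
    using pfaff_congruence[of "1\<^sub>m (2*n)" n] by simp
  then have "?K = det g * ?K" using pfaff_congruence[OF g] sp by simp
  then show ?thesis using pfaff_term_sum_nz[of n] by simp
qed

section \<open>Square roots of upper triangular matrices\<close>

lemma quadratic_root:
  fixes A B C :: complex
  assumes "A = 0 \<Longrightarrow> B \<noteq> 0"
  obtains s where "A * s * s + B * s + C = 0"
proof (cases "A = 0")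
  case True
  then show ?thesis using assms that[of "- C / B"] by simp
next
  case False
  define d where "d = csqrt (B\<^sup>2 - 4 * A * C)"
  have d: "d * d = B * B - 4 * A * C" using power2_csqrt[of "B\<^sup>2 - 4 * A * C"] by (simp add: d_def power2_eq_square)
  define s where "s = (d - B) / (2 * A)"
  have s: "2 * A * s = d - B" using False by (simp add: s_def)
  have "4 * A * (A * s * s + B * s + C) = (2 * A * s) * (2 * A * s) + 2 * B * (2 * A * s) + 4 * A * C"
    by (simp add: algebra_simps)
  also have "\<dots> = d * d - B * B + 4 * A * C" unfolding s by (simp add: algebra_simps)
  also have "\<dots> = 0" unfolding d by simp
  finally show ?thesis using that[of s] False by simp
qed

text \<open>Hensel lifting one root \<open>a\<close> at a time: the correction term solves a quadratic equation, which
  degenerates to a linear one with leading coefficient \<open>2 p(a) \<noteq> 0\<close> when \<open>a\<close> is a repeated root.\<close>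

lemma poly_sqrt_mod:
  assumes "0 \<notin> set as"
  shows "\<exists>p::complex poly. (\<Prod>a\<leftarrow>as. [:-a, 1:]) dvd p * p - [:0, 1:]"
  using assms
proof (induction as)
  case Nil
  show ?case by simp
next
  case (Cons a as)
  let ?m = "\<Prod>a\<leftarrow>as. [:-a, 1:]"
  from Cons obtain p r where pq: "p * p - [:0, 1:] = ?m * r" by (auto simp: dvd_def)
  have ev: "poly p a * poly p a - a = poly ?m a * poly r a"
    using arg_cong[OF pq, of "\<lambda>q. poly q a"] by simp
  have "2 * poly p a \<noteq> 0" if "poly ?m a = 0"
    \<comment> \<open>At a zero \<open>a\<close> of the modulus, p(a)^2 = a, which is
      nonzero.\<close>
    using ev that Cons.prems by auto
  then obtain s where s: "poly ?m a * s * s + 2 * poly p a * s + poly r a = 0"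
    using quadratic_root by metis
  \<comment> \<open>The cofactor of the modulus m in (p + s m)^2 - X; \<open>s\<close> was chosen to
    make it vanish at \<open>a\<close>.\<close>
  let ?w = "r + smult (2 * s) p + smult (s * s) ?m"
  have "poly ?w a = 0" using s by (simp add: algebra_simps)
  then have "[:-a, 1:] dvd ?w" by (simp only: poly_eq_0_iff_dvd)
  moreover have "(p + smult s ?m) * (p + smult s ?m) - [:0, 1:] = ?w * ?m"
  proof -
    have 2: "smult (2 * s) p = smult s p + smult s p" unfolding mult_2 smult_add_left ..
    have "(p + smult s m) * (p + smult s m) - x = (p * p - x) + smult (2 * s) p * m + smult (s * s) m * m"
      for m x unfolding 2 by (simp add: algebra_simps)
    from this[of ?m "[:0, 1:]"] have "(p + smult s ?m) * (p + smult s ?m) - [:0, 1:]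
        = (p * p - [:0, 1:]) + smult (2 * s) p * ?m + smult (s * s) ?m * ?m" .
    also have "\<dots> = ?w * ?m" unfolding pq by (simp add: algebra_simps)
    finally show ?thesis .
  qed
  ultimately have "[:-a, 1:] * ?m dvd (p + smult s ?m) * (p + smult s ?m) - [:0, 1:]"
    by (simp only: mult_dvd_mono dvd_refl)
  then show ?case by (intro exI[of _ "p + smult s ?m"]) (simp only: list.map prod_list.Cons)
qed

section \<open>Polynomials evaluated at a triangular matrix\<close>

definition mat_eval :: "nat \<Rightarrow> complex mat \<Rightarrow> complex poly \<Rightarrow> complex mat" where
  "mat_eval N b p = fold_coeffs (\<lambda>a X. a \<cdot>\<^sub>m 1\<^sub>m N + b * X) p (0\<^sub>m N N)"

context
  fixes N :: nat and b :: "complex mat"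
  assumes b: "b \<in> carrier_mat N N"
begin

lemma mat_eval_0: "mat_eval N b 0 = 0\<^sub>m N N"
  by (simp add: mat_eval_def)

lemma mat_eval_pCons: "mat_eval N b (pCons a p) = a \<cdot>\<^sub>m 1\<^sub>m N + b * mat_eval N b p"
proof (cases "a = 0 \<and> p = 0")
  case True
  have "0 \<cdot>\<^sub>m 1\<^sub>m N + b * 0\<^sub>m N N = 0\<^sub>m N N" using b by (auto intro!: eq_matI)
  then show ?thesis using True by (simp add: mat_eval_0)
qed (auto simp: mat_eval_def)

lemma mat_eval_carrier: "mat_eval N b p \<in> carrier_mat N N"
  by (induction p) (use b in \<open>auto simp: mat_eval_0 mat_eval_pCons\<close>)

lemma mat_eval_add: "mat_eval N b (p + q) = mat_eval N b p + mat_eval N b q"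
proof (induction p q rule: poly_induct2)
  case (pCons a p c q)
  have "mat_eval N b (pCons a p + pCons c q) = (a + c) \<cdot>\<^sub>m 1\<^sub>m N + (b * mat_eval N b p + b * mat_eval N b q)"
    using mult_add_distrib_mat[OF b mat_eval_carrier mat_eval_carrier]
    by (simp add: mat_eval_pCons pCons.IH)
  also have "\<dots> = (a \<cdot>\<^sub>m 1\<^sub>m N + b * mat_eval N b p) + (c \<cdot>\<^sub>m 1\<^sub>m N + b * mat_eval N b q)"
    using b mat_eval_carrier[of p] mat_eval_carrier[of q]
    by (intro eq_matI) (auto simp: algebra_simps simp del: index_mult_mat(1))
  finally show ?case by (simp add: mat_eval_pCons)
qed (simp add: mat_eval_0)

lemma mat_eval_smult: "mat_eval N b (smult c p) = c \<cdot>\<^sub>m mat_eval N b p"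
proof (induction p)
  case (pCons a p)
  show ?case
    using b mat_eval_carrier[of p] mult_smult_distrib[OF b mat_eval_carrier[of p], of c]
    by (intro eq_matI) (auto simp: mat_eval_pCons pCons.IH algebra_simps simp del: index_mult_mat(1))
qed (auto simp: mat_eval_0 intro!: eq_matI)

lemma mat_eval_mult: "mat_eval N b (p * q) = mat_eval N b p * mat_eval N b q"
proof (induction p)
  case (pCons a p)
  note c = mat_eval_carrier
  have "0 \<cdot>\<^sub>m 1\<^sub>m N + x = x" if "x \<in> carrier_mat N N" for x :: "complex mat"
    using that by (intro eq_matI) auto
  then have "mat_eval N b (pCons a p * q) = a \<cdot>\<^sub>m mat_eval N b q + b * (mat_eval N b p * mat_eval N b q)"
    using b c[of p] c[of q] by (simp add: mat_eval_add mat_eval_smult mat_eval_pCons pCons.IH)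
  also have "\<dots> = (a \<cdot>\<^sub>m 1\<^sub>m N + b * mat_eval N b p) * mat_eval N b q"
    using b c[of p] c[of q]
    by (simp add: add_mult_distrib_mat[of _ N N] mult_smult_assoc_mat[of _ N N] assoc_mult_mat[of _ N N _ N _ N])
  finally show ?case by (simp add: mat_eval_pCons)
qed (simp add: mat_eval_0 left_mult_zero_mat[OF mat_eval_carrier])

lemma mat_eval_X: "mat_eval N b [:c, 1:] = c \<cdot>\<^sub>m 1\<^sub>m N + b"
proof -
  have "mat_eval N b [:1:] = 1\<^sub>m N"
    using b by (simp add: mat_eval_pCons mat_eval_0) (auto intro!: eq_matI)
  then show ?thesis using b by (simp add: mat_eval_pCons[of c])
qed

lemma mat_eval_comm: "b * mat_eval N b p = mat_eval N b p * b"
proof -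
  have X: "mat_eval N b [:0, 1:] = b" using b by (simp add: mat_eval_X) (auto intro!: eq_matI)
  show ?thesis using mat_eval_mult[of "[:0, 1:]" p] mat_eval_mult[of p "[:0, 1:]"] unfolding X
    by (simp add: mult.commute)
qed

lemma mat_eval_upper: "upper_triangular b \<Longrightarrow> upper_triangular (mat_eval N b p)"
proof (induction p)
  case (pCons a p)
  then have "upper_triangular (b * mat_eval N b p)"
    using upper_triangular_mult[OF b mat_eval_carrier] by blast
  then show ?case using b mat_eval_carrier[of p]
    by (auto simp: mat_eval_pCons upper_triangular_def simp del: index_mult_mat(1))
qed (auto simp: mat_eval_0)

text \<open>Cayley-Hamilton, column by column. The factor b - b_kk maps the first k+1 basis vectors
  into the span of the first k, which the earlier factors annihilate. At \<open>k = N\<close> the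
  product is zero.\<close>

lemma mat_eval_diag_roots:
  assumes u: "upper_triangular b" and "k \<le> N" "i < N" "j < k"
  shows "mat_eval N b (\<Prod>a\<leftarrow>map (\<lambda>l. b $$ (l,l)) [0..<k]. [:-a, 1:]) $$ (i,j) = 0"
  using assms(2-4)
proof (induction k arbitrary: i j)
  case (Suc k)
  let ?m = "mat_eval N b (\<Prod>a\<leftarrow>map (\<lambda>l. b $$ (l,l)) [0..<k]. [:-a, 1:])"
  let ?x = "(- b $$ (k,k)) \<cdot>\<^sub>m 1\<^sub>m N + b"
  have "mat_eval N b (\<Prod>a\<leftarrow>map (\<lambda>l. b $$ (l,l)) [0..<Suc k]. [:-a, 1:]) = ?m * ?x"
  proof -
    have "(\<Prod>a\<leftarrow>map (\<lambda>l. b $$ (l,l)) [0..<Suc k]. [:-a, 1:])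
        = (\<Prod>a\<leftarrow>map (\<lambda>l. b $$ (l,l)) [0..<k]. [:-a, 1:]) * [:- b $$ (k,k), 1:]"
      by (simp del: mult_pCons_right)
    then show ?thesis by (simp only: mat_eval_mult mat_eval_X)
  qed
  moreover have "(?m * ?x) $$ (i,j) = (\<Sum>v<N. ?m $$ (i,v) * ?x $$ (v,j))"
    using Suc.prems b by (subst index_mult_sum) (simp_all add: carrier_matD[OF mat_eval_carrier])
  moreover have "\<dots> = 0"
  proof (rule sum.neutral, rule ballI)
    fix v assume v: "v \<in> {..<N}"
    show "?m $$ (i,v) * ?x $$ (v,j) = 0"
    proof (cases "v < k")
      case True
      then show ?thesis using Suc.IH[of i v] Suc.prems by simp
    next
      case False
      then have "?x $$ (v,j) = 0"
        using v Suc.prems b upper_triangularD[OF u, of j v] by (cases "v = j") (auto simp: less_Suc_eq)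
      then show ?thesis by simp
    qed
  qed
  ultimately show ?case by simp
qed simp

text \<open>Evaluates at b a square root of X modulo the product of all X - b_ii. The conclusion
  provides a polynomial so that shape and symmetry can be transferred from b.\<close>

lemma upper_triangular_sqrt:
  assumes u: "upper_triangular b" and nz: "\<And>i. i < N \<Longrightarrow> b $$ (i,i) \<noteq> 0"
  shows "\<exists>p. mat_eval N b p * mat_eval N b p = b"
proof -
  let ?as = "map (\<lambda>l. b $$ (l,l)) [0..<N]"
  obtain p r where p: "p * p - [:0, 1:] = (\<Prod>a\<leftarrow>?as. [:-a, 1:]) * r"
    using poly_sqrt_mod[of ?as] nz by (fastforce simp: dvd_def)
  have "mat_eval N b (\<Prod>a\<leftarrow>?as. [:-a, 1:]) = 0\<^sub>m N N"
    using mat_eval_diag_roots[OF u, of N] by (intro eq_matI) (simp_all add: carrier_matD[OF mat_eval_carrier] del: map_map)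
  moreover have "p * p = (\<Prod>a\<leftarrow>?as. [:-a, 1:]) * r + [:0, 1:]" using p by (simp add: algebra_simps)
  then have "mat_eval N b p * mat_eval N b p
     = mat_eval N b (\<Prod>a\<leftarrow>?as. [:-a, 1:]) * mat_eval N b r + mat_eval N b [:0, 1:]"
    by (metis mat_eval_add mat_eval_mult)
  ultimately have "mat_eval N b p * mat_eval N b p = 0\<^sub>m N N + (0 \<cdot>\<^sub>m 1\<^sub>m N + b)"
    using mat_eval_carrier[of r] by (simp only: mat_eval_X left_mult_zero_mat)
  also have "\<dots> = b" using b by (intro eq_matI) auto
  finally show ?thesis by blast
qed

end

text \<open>The relation says that b is self-adjoint for the symplectic form. Transposition reverses
  the product of b with a polynomial in b, and \<open>mat_eval_comm\<close> restores the
  order.\<close>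

lemma mat_eval_Emat:
  assumes b: "b \<in> carrier_mat (2*n) (2*n)" and sym: "Emat n * transpose_mat b = b * Emat n"
  shows "Emat n * transpose_mat (mat_eval (2*n) b p) = mat_eval (2*n) b p * Emat n"
proof (induction p)
  case 0
  then show ?case by (simp add: mat_eval_0[OF b])
next
  case (pCons a p)
  let ?N = "2*n" and ?E = "Emat n"
  let ?X = "mat_eval ?N b p"
  note X = mat_eval_carrier[OF b, of p]
  note as = assoc_mult_mat[of _ ?N ?N _ ?N _ ?N]
  have "?E * transpose_mat (mat_eval ?N b (pCons a p)) = ?E * (a \<cdot>\<^sub>m 1\<^sub>m ?N + transpose_mat ?X * transpose_mat b)"
  proof -
    have "transpose_mat (a \<cdot>\<^sub>m 1\<^sub>m ?N + b * ?X) = a \<cdot>\<^sub>m 1\<^sub>m ?N + transpose_mat (b * ?X)"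
      using b X by (intro eq_matI) (auto simp del: index_mult_mat(1))
    then show ?thesis using transpose_mult[OF b X] by (simp add: mat_eval_pCons[OF b])
  qed
  also have "\<dots> = a \<cdot>\<^sub>m ?E + (?E * transpose_mat ?X) * transpose_mat b"
    using b X mult_smult_distrib[OF Emat_carrier one_carrier_mat, of n a]
      right_mult_one_mat[OF Emat_carrier[of n]]
    by (simp add: mult_add_distrib_mat[of _ ?N ?N _ ?N] as)
  also have "\<dots> = a \<cdot>\<^sub>m ?E + ?X * (?E * transpose_mat b)"
    unfolding pCons.IH using b X by (simp add: as)
  also have "\<dots> = a \<cdot>\<^sub>m ?E + (b * ?X) * ?E"
    unfolding sym mat_eval_comm[OF b] using b X by (simp add: as)
  also have "\<dots> = mat_eval ?N b (pCons a p) * ?E"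
    using b X mult_smult_assoc_mat[OF one_carrier_mat Emat_carrier, of a n]
      left_mult_one_mat[OF Emat_carrier[of n]]
    by (simp add: mat_eval_pCons[OF b]
        add_mult_distrib_mat[OF smult_carrier_mat[OF one_carrier_mat] mult_carrier_mat[OF b X] Emat_carrier])
  finally show ?case .
qed

section \<open>Fixed flags\<close>

lemma Emat_sq: "Emat n * Emat n = (-1) \<cdot>\<^sub>m 1\<^sub>m (2*n)"
proof (rule eq_matI)
  fix i j assume "i < dim_row ((-1 :: complex) \<cdot>\<^sub>m 1\<^sub>m (2*n))" "j < dim_col ((-1 :: complex) \<cdot>\<^sub>m 1\<^sub>m (2*n))"
  then have ij: "i < 2*n" "j < 2*n" by simp_all
  then show "(Emat n * Emat n) $$ (i,j) = ((-1) \<cdot>\<^sub>m 1\<^sub>m (2*n)) $$ (i,j)"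
    by (auto simp: Emat_mult_left[OF Emat_carrier ij] Emat_index simp del: index_mult_mat(1))
qed simp_all

lemma Emat_transpose: "transpose_mat (Emat n) = (-1) \<cdot>\<^sub>m Emat n"
proof (rule eq_matI)
  fix i j assume "i < dim_row ((-1) \<cdot>\<^sub>m Emat n)" "j < dim_col ((-1) \<cdot>\<^sub>m Emat n)"
  then have ij: "i < 2*n" "j < 2*n" by simp_all
  have "(i = mirror n j) = (j = mirror n i)" using mirror_swap[OF ij] by auto
  moreover have "esign n j = - esign n i" if "j = mirror n i" using that ij by simp
  ultimately show "transpose_mat (Emat n) $$ (i,j) = ((-1) \<cdot>\<^sub>m Emat n) $$ (i,j)"
    using ij by (simp add: Emat_index)
qed simp_all

lemma Emat_inverse: "Emat n * ((-1) \<cdot>\<^sub>m Emat n) = 1\<^sub>m (2*n)" "((-1) \<cdot>\<^sub>m Emat n) * Emat n = 1\<^sub>m (2*n)"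
proof -
  have "(-1) \<cdot>\<^sub>m ((-1) \<cdot>\<^sub>m 1\<^sub>m (2*n)) = (1\<^sub>m (2*n) :: complex mat)" by (intro eq_matI) auto
  then show "Emat n * ((-1) \<cdot>\<^sub>m Emat n) = 1\<^sub>m (2*n)" "((-1) \<cdot>\<^sub>m Emat n) * Emat n = 1\<^sub>m (2*n)"
    using mult_smult_distrib[OF Emat_carrier Emat_carrier, of n "-1"]
      mult_smult_assoc_mat[OF Emat_carrier Emat_carrier, of "-1" n] Emat_sq[of n] by simp_all
qed

lemma minv_Emat: "minv (Emat n) = (-1) \<cdot>\<^sub>m Emat n"
  by (rule minv_unique[OF Emat_carrier _ Emat_inverse(1)]) simp

lemma det_Emat: "det (Emat n) \<noteq> 0"
proof
  assume "det (Emat n) = 0"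
  then have "det (Emat n * ((-1) \<cdot>\<^sub>m Emat n)) = 0" by (subst det_mult[of _ "2*n"]) auto
  then show False by (simp only: Emat_inverse det_one one_neq_zero)
qed

section \<open>The involution on the group and on the Borel subgroup\<close>

lemma SL_carrier: "g \<in> SL n \<Longrightarrow> g \<in> carrier_mat (2*n) (2*n)"
  and SL_det: "g \<in> SL n \<Longrightarrow> det g = 1"
  by (simp_all add: SL_def)

lemma SL_mult: "g \<in> SL n \<Longrightarrow> h \<in> SL n \<Longrightarrow> g * h \<in> SL n"
  by (simp add: SL_def det_mult[of _ "2*n"] mult_carrier_mat[of _ "2*n" "2*n" _ "2*n"])

lemma SL_minv:
  assumes "g \<in> SL n"
  shows "minv g \<in> SL n" "g * minv g = 1\<^sub>m (2*n)" "minv g * g = 1\<^sub>m (2*n)"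
proof -
  note c = SL_carrier[OF assms] and d = SL_det[OF assms]
  note m = minv[OF c] 
  show 1: "g * minv g = 1\<^sub>m (2*n)" "minv g * g = 1\<^sub>m (2*n)" using m d by simp_all
  have "det g * det (minv g) = 1"
    using det_mult[OF c m(1)] 1(1) d by simp
  then show "minv g \<in> SL n" using m d by (simp add: SL_def)
qed

text \<open>Characterizes sigma(g) as the unique X with X E g^T = E, which spares later proofs the
  two inverses.\<close>

lemma sigma_grp_eq:
  assumes g: "g \<in> SL n"
  shows "sigma_grp n g \<in> carrier_mat (2*n) (2*n)" "sigma_grp n g * Emat n * transpose_mat g = Emat n"
    and "X \<in> carrier_mat (2*n) (2*n) \<Longrightarrow> X * Emat n * transpose_mat g = Emat n \<Longrightarrow> sigma_grp n g = X"
proof -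
  let ?N = "2*n" and ?E = "Emat n" and ?g = "transpose_mat g"
  let ?F = "(-1) \<cdot>\<^sub>m ?E" and ?h = "minv ?g"
  have gc: "?g \<in> carrier_mat ?N ?N" using SL_carrier[OF g] by simp
  have "det ?g = 1" using det_transpose[OF SL_carrier[OF g]] SL_det[OF g] by simp
  then have h: "?h \<in> carrier_mat ?N ?N" "?g * ?h = 1\<^sub>m ?N" "?h * ?g = 1\<^sub>m ?N" using minv[OF gc] by simp_all
  note as = assoc_mult_mat[of _ ?N ?N _ ?N _ ?N] mult_carrier_mat[of _ ?N ?N _ ?N]
  have F: "?F \<in> carrier_mat ?N ?N" by simp
  have eq: "sigma_grp n g = ?E * ?h * ?F" by (simp add: sigma_grp_def minv_Emat)
  show "sigma_grp n g \<in> carrier_mat ?N ?N" unfolding eq using h F by (meson Emat_carrier mult_carrier_mat)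
  have "?E * ?h * ?F * ?E * ?g = ?E * (?h * ((?F * ?E) * ?g))"
    using h F gc by (simp add: as del: smult_carrier_mat)
  also have "\<dots> = ?E" unfolding Emat_inverse using gc h by simp
  finally show "sigma_grp n g * ?E * ?g = ?E" unfolding eq .
  assume X: "X \<in> carrier_mat ?N ?N" "X * ?E * ?g = ?E"
  have "?E * ?h * ?F = X * ?E * ?g * ?h * ?F" using X by simp
  also have "\<dots> = X * (?E * ((?g * ?h) * ?F))" using h F gc X(1) by (simp add: as)
  also have "\<dots> = X" unfolding h(2) left_mult_one_mat[OF F] Emat_inverse using X by simp
  finally show "sigma_grp n g = X" unfolding eq .
qed

lemma sigma_grp_mult:
  assumes g: "g \<in> SL n" and b: "b \<in> SL n"
  shows "sigma_grp n (g * b) = sigma_grp n g * sigma_grp n b"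
proof (rule sigma_grp_eq(3)[OF SL_mult[OF g b]])
  let ?N = "2*n" and ?E = "Emat n"
  note esign = sigma_grp_eq(1,2)[OF g] and sb = sigma_grp_eq(1,2)[OF b]
  note gc = SL_carrier[OF g] and bc = SL_carrier[OF b]
  note as = assoc_mult_mat[of _ ?N ?N _ ?N _ ?N] mult_carrier_mat[of _ ?N ?N _ ?N]
  show "sigma_grp n g * sigma_grp n b \<in> carrier_mat ?N ?N" using esign sb by simp
  have "sigma_grp n g * sigma_grp n b * ?E * transpose_mat (g * b)
      = sigma_grp n g * (sigma_grp n b * ?E * transpose_mat b) * transpose_mat g"
    using esign(1) sb(1) gc bc by (simp add: transpose_mult[OF gc bc] as)
  then show "sigma_grp n g * sigma_grp n b * ?E * transpose_mat (g * b) = ?E" using esign sb by simp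
qed

lemma SL_sigma_grp: "g \<in> SL n \<Longrightarrow> sigma_grp n g \<in> SL n"
proof -
  assume g: "g \<in> SL n"
  note s = sigma_grp_eq(1,2)[OF g]
  have "det (sigma_grp n g) * det (Emat n) * det (transpose_mat g) = det (Emat n)"
    using arg_cong[OF s(2), of det] s(1) SL_carrier[OF g] by (simp add: det_mult[of _ "2*n"])
  then show ?thesis using s det_transpose[OF SL_carrier[OF g]] SL_det[OF g] det_Emat[of n] by (simp add: SL_def)
qed

lemma Bor_SL: "b \<in> Bor n \<Longrightarrow> b \<in> SL n"
  by (simp add: Bor_def)

lemma BC_Bor: "b \<in> BC n \<Longrightarrow> b \<in> Bor n"
  by (simp add: BC_def)

lemma GC_SL: "g \<in> GC n \<Longrightarrow> g \<in> SL n"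
  by (simp add: GC_def)

lemma Bor_one: "1\<^sub>m (2*n) \<in> Bor n"
  by (auto simp: Bor_def SL_def)

lemma BC_one: "1\<^sub>m (2*n) \<in> BC n"
  unfolding BC_def mem_Collect_eq
  by (intro conjI Bor_one sigma_grp_eq(3)) (simp_all add: Bor_SL[OF Bor_one])

lemma Bor_mult: "b \<in> Bor n \<Longrightarrow> c \<in> Bor n \<Longrightarrow> b * c \<in> Bor n"
  using SL_mult[of b n c] upper_triangular_mult[of b "2*n" c] SL_carrier by (simp add: Bor_def)

lemma Bor_minv: "b \<in> Bor n \<Longrightarrow> minv b \<in> Bor n"
  using SL_minv(1)[of b n] upper_triangular_minv[of b "2*n"] SL_carrier[of b n] SL_det[of b n] by (simp add: Bor_def)

text \<open>On the group, sigma(b) is minus \<open>sigma_alg\<close> of the inverse of b, and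
  reflection in the antidiagonal keeps upper triangular matrices upper triangular.\<close>

lemma Bor_sigma_grp:
  assumes b: "b \<in> Bor n"
  shows "sigma_grp n b \<in> Bor n"
proof -
  let ?N = "2*n"
  note bS = Bor_SL[OF b]
  note bc = SL_carrier[OF bS] and m = SL_minv[OF bS] and mB = Bor_minv[OF b]
  note mc = SL_carrier[OF m(1)]
  have "transpose_mat b * transpose_mat (minv b) = transpose_mat (minv b * b)"
    by (rule transpose_mult[OF mc bc, symmetric])
  also have "\<dots> = 1\<^sub>m ?N" unfolding m by simp
  finally have "minv (transpose_mat b) = transpose_mat (minv b)" using bc mc by (intro minv_unique) auto
  then have "sigma_grp n b = Emat n * transpose_mat (minv b) * ((-1) \<cdot>\<^sub>m Emat n)"
    by (simp add: sigma_grp_def minv_Emat)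
  also have "\<dots> = (-1) \<cdot>\<^sub>m sigma_alg n (minv b)"
    unfolding sigma_alg_def using mc by (intro mult_smult_distrib[of _ ?N ?N _ ?N]) auto
  finally have "upper_triangular (sigma_grp n b)"
    using mB mc upper_triangularD[of "minv b"] by (auto simp: upper_triangular_def sigma_alg_index Bor_def)
  then show ?thesis using SL_sigma_grp[OF bS] by (simp add: Bor_def)
qed

section \<open>Flags as cosets, and independence of representatives\<close>

lemma cosetA_mult:
  assumes g: "g \<in> SL n" and b: "b \<in> Bor n"
  shows "cosetA n (g * b) = cosetA n g"
proof (intro Set.equalityI Set.subsetI)
  note gc = SL_carrier[OF g] and bc = SL_carrier[OF Bor_SL[OF b]]
  note m = SL_minv[OF Bor_SL[OF b]]
  note mc = SL_carrier[OF m(1)]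
  fix x assume "x \<in> cosetA n (g * b)"
  then obtain c where c: "c \<in> Bor n" "x = g * b * c" by (auto simp: cosetA_def)
  then have "x = g * (b * c)" using assoc_mult_mat[OF gc bc SL_carrier[OF Bor_SL[OF c(1)]]] by simp
  then show "x \<in> cosetA n g" using Bor_mult[OF b c(1)] by (auto simp: cosetA_def)
next
  note gc = SL_carrier[OF g] and bc = SL_carrier[OF Bor_SL[OF b]]
  note m = SL_minv[OF Bor_SL[OF b]]
  note mc = SL_carrier[OF m(1)]
  fix x assume "x \<in> cosetA n g"
  then obtain c where c: "c \<in> Bor n" "x = g * c" by (auto simp: cosetA_def)
  note cc = SL_carrier[OF Bor_SL[OF c(1)]]
  have "g * b * (minv b * c) = g * ((b * minv b) * c)"
    using gc bc mc cc by (simp add: assoc_mult_mat[of _ "2*n" "2*n" _ "2*n" _ "2*n"])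
  also have "\<dots> = x" unfolding m using c cc by simp
  finally show "x \<in> cosetA n (g * b)" using Bor_mult[OF Bor_minv[OF b] c(1)] unfolding cosetA_def by blast
qed

lemma cosetA_eqD:
  assumes "g' \<in> SL n" "cosetA n g = cosetA n g'"
  shows "\<exists>b\<in>Bor n. g' = g * b"
proof -
  have "g' = g' * 1\<^sub>m (2*n)" using SL_carrier[OF assms(1)] by simp
  then have "g' \<in> cosetA n g'" using Bor_one unfolding cosetA_def by blast
  then show ?thesis using assms(2) by (auto simp: cosetA_def)
qed

lemma cosetC_eqD:
  assumes "g' \<in> GC n" "cosetC n g = cosetC n g'"
  shows "\<exists>b\<in>BC n. g' = g * b"
proof -
  have "g' = g' * 1\<^sub>m (2*n)" using SL_carrier[OF GC_SL[OF assms(1)]] by simp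
  then have "g' \<in> cosetC n g'" using BC_one unfolding cosetC_def by blast
  then show ?thesis using assms(2) by (auto simp: cosetC_def)
qed

text \<open>The representative chosen by \<open>SOME\<close> differs from \<open>g\<close> by an
  element of \<open>BC\<close>, hence of \<open>Bor\<close>.\<close>

lemma phi'_cosetC:
  assumes g: "g \<in> GC n"
  shows "phi' n (cosetC n g) = cosetA n g"
proof -
  define g' where "g' = (SOME g'. g' \<in> GC n \<and> cosetC n g = cosetC n g')"
  have "g' \<in> GC n \<and> cosetC n g = cosetC n g'" unfolding g'_def by (rule someI[of _ g]) (use g in simp)
  then obtain b where "b \<in> BC n" "g' = g * b" using cosetC_eqD by blast
  then have "cosetA n g' = cosetA n g" using cosetA_mult[OF GC_SL[OF g] BC_Bor] by simp
  then show ?thesis unfolding phi'_def g'_def .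
qed

text \<open>The chosen representative is g b with b in B, and sigma(g b) = sigma(g) sigma(b), where
  sigma(b) is again in B.\<close>

lemma sigma_flag_cosetA:
  assumes g: "g \<in> SL n"
  shows "sigma_flag n (cosetA n g) = cosetA n (sigma_grp n g)"
proof -
  define g' where "g' = (SOME g'. g' \<in> SL n \<and> cosetA n g = cosetA n g')"
  have "g' \<in> SL n \<and> cosetA n g = cosetA n g'" unfolding g'_def by (rule someI[of _ g]) (use g in simp)
  then obtain b where b: "b \<in> Bor n" "g' = g * b" using cosetA_eqD by blast
  then have "cosetA n (sigma_grp n g') = cosetA n (sigma_grp n g)"
    using sigma_grp_mult[OF g Bor_SL[OF b(1)]] cosetA_mult[OF SL_sigma_grp[OF g] Bor_sigma_grp[OF b(1)]] by simp
  then show ?thesis unfolding sigma_flag_def g'_def .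
qed

section \<open>Symplectic representatives of fixed flags\<close>

lemma GC_iff: "g \<in> GC n \<longleftrightarrow> g \<in> SL n \<and> g * Emat n * transpose_mat g = Emat n"
  using sigma_grp_eq[of g n] SL_carrier[of g n] unfolding GC_def by auto

text \<open>For symplectic g, moving E past a transpose turns g^T into the inverse of g, and the
  transposed inverse into g; this leaves sigma(x) = x in the middle.\<close>

lemma sigma_alg_conj:
  assumes g: "g \<in> GC n" and x: "x \<in> gC n"
  shows "sigma_alg n (minv g * x * g) = minv g * x * g"
proof -
  let ?N = "2*n" and ?E = "Emat n"
  let ?h = "minv g" and ?F = "(-1) \<cdot>\<^sub>m Emat n"
  note as = assoc_mult_mat[of _ ?N ?N _ ?N _ ?N] mult_carrier_mat[of _ ?N ?N _ ?N]
  have gS: "g \<in> SL n" and sp: "g * ?E * transpose_mat g = ?E" using g GC_iff by auto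
  note gc = SL_carrier[OF gS] and h = SL_minv[OF gS] and xc = gC_carrier[OF x]
  note hc = SL_carrier[OF h(1)]
  have tg: "transpose_mat g \<in> carrier_mat ?N ?N" "transpose_mat ?h \<in> carrier_mat ?N ?N"
    "transpose_mat x \<in> carrier_mat ?N ?N" using gc hc xc by auto
  have F: "?F \<in> carrier_mat ?N ?N" by simp
  have 1: "?E * transpose_mat g = ?h * ?E"
  proof -
    have "?E * transpose_mat g = (?h * g) * (?E * transpose_mat g)" unfolding h using tg by simp
    also have "\<dots> = ?h * (g * ?E * transpose_mat g)" using gc hc tg by (simp add: as)
    finally show ?thesis unfolding sp .
  qed
  have 2: "transpose_mat ?h * ?E = ?E * g"
  proof -
    have "transpose_mat (?E * transpose_mat g) = transpose_mat (?h * ?E)" using 1 by simp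
    then have "g * transpose_mat ?E = transpose_mat ?E * transpose_mat ?h"
      using transpose_mult[OF Emat_carrier tg(1)] transpose_mult[OF hc Emat_carrier] by simp
    then have gF: "g * ?F = ?F * transpose_mat ?h" unfolding Emat_transpose .
    have "?E * g = ?E * g * (?F * ?E)" unfolding Emat_inverse using gc by simp
    also have "\<dots> = ?E * (g * ?F) * ?E" using gc F by (simp add: as)
    also have "\<dots> = (?E * ?F) * transpose_mat ?h * ?E" unfolding gF using tg F by (simp add: as)
    also have "\<dots> = transpose_mat ?h * ?E" unfolding Emat_inverse using tg by simp
    finally show ?thesis by simp
  qed
  have "transpose_mat (?h * x * g) = transpose_mat g * (transpose_mat x * transpose_mat ?h)"
    using transpose_mult[OF mult_carrier_mat[OF hc xc] gc] transpose_mult[OF hc xc] by simp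
  then have "sigma_alg n (?h * x * g) = (?E * transpose_mat g) * transpose_mat x * (transpose_mat ?h * ?E)"
    unfolding sigma_alg_def using tg by (simp add: as)
  also have "\<dots> = ?h * (?E * transpose_mat x * ?E) * g" unfolding 1 2 using tg gc hc by (simp add: as)
  also have "?E * transpose_mat x * ?E = x" using x by (simp add: gC_def sigma_alg_def)
  finally show ?thesis .
qed

text \<open>With c c = b and E c^T = c E, one gets (g c) E (g c)^T = g c c E g^T = g b E g^T, and
  the last product is E because sigma(g) = g b.\<close>

lemma fixed_flag_symplectic:
  assumes g: "g \<in> SL n" and fixed: "cosetA n (sigma_grp n g) = cosetA n g"
  shows "\<exists>c\<in>Bor n. g * c \<in> GC n"
proof -
  let ?N = "2*n" and ?E = "Emat n"
  note as = assoc_mult_mat[of _ ?N ?N _ ?N _ ?N] mult_carrier_mat[of _ ?N ?N _ ?N]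
  obtain b where bB: "b \<in> Bor n" and sb: "sigma_grp n g = g * b"
    using cosetA_eqD[OF SL_sigma_grp[OF g], of g] fixed by auto
  note b = SL_carrier[OF Bor_SL[OF bB]] and gc = SL_carrier[OF g]
  note h = SL_minv[OF g]
  note hc = SL_carrier[OF h(1)]
  have ub: "upper_triangular b" using bB by (simp add: Bor_def)
  have tg: "transpose_mat g \<in> carrier_mat ?N ?N" "transpose_mat (minv g) \<in> carrier_mat ?N ?N"
    using gc hc by auto
  have form: "g * b * ?E * transpose_mat g = ?E" using sigma_grp_eq(2)[OF g] unfolding sb .
  \<comment> \<open>By \<open>form\<close>, b E is congruent to the antisymmetric E and hence
    antisymmetric; its transpose is -(E b^T).\<close>
  have sym: "?E * transpose_mat b = b * ?E"
  proof -
    have "transpose_mat (g * (b * ?E) * transpose_mat g) = transpose_mat ?E"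
      using form gc b tg by (simp add: as)
    moreover have "transpose_mat (g * (b * ?E) * transpose_mat g) = g * transpose_mat (b * ?E) * transpose_mat g"
      using transpose_mult[OF mult_carrier_mat[OF gc mult_carrier_mat[OF b Emat_carrier]] tg(1)]
        transpose_mult[OF gc mult_carrier_mat[OF b Emat_carrier]] gc b tg by (simp add: as)
    moreover have "transpose_mat (b * ?E) = (-1) \<cdot>\<^sub>m (?E * transpose_mat b)"
      using transpose_mult[OF b Emat_carrier] b by (simp add: Emat_transpose mult_smult_assoc_mat[of _ ?N ?N _ ?N])
    ultimately have 1: "g * ((-1) \<cdot>\<^sub>m (?E * transpose_mat b)) * transpose_mat g = (-1) \<cdot>\<^sub>m ?E"
      by (simp add: Emat_transpose)
    have Et: "?E * transpose_mat b \<in> carrier_mat ?N ?N" using b by (intro mult_carrier_mat) auto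
    have "g * ((-1) \<cdot>\<^sub>m (?E * transpose_mat b)) * transpose_mat g = (-1) \<cdot>\<^sub>m (g * (?E * transpose_mat b) * transpose_mat g)"
      using mult_smult_distrib[OF gc Et] mult_smult_assoc_mat[OF mult_carrier_mat[OF gc Et] tg(1)] by simp
    then have "(-1) \<cdot>\<^sub>m (g * (?E * transpose_mat b) * transpose_mat g) = (-1) \<cdot>\<^sub>m ?E" using 1 by simp
    then have "(-1) \<cdot>\<^sub>m ((-1) \<cdot>\<^sub>m (g * (?E * transpose_mat b) * transpose_mat g)) = (-1) \<cdot>\<^sub>m ((-1) \<cdot>\<^sub>m ?E)" by simp
    moreover have "(-1) \<cdot>\<^sub>m ((-1) \<cdot>\<^sub>m M) = M" for M :: "complex mat" by (intro eq_matI) auto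
    ultimately have 2: "g * (?E * transpose_mat b) * transpose_mat g = g * (b * ?E) * transpose_mat g"
      using form gc b tg by (simp add: as)
    have cancel: "minv g * (g * Y * transpose_mat g) * transpose_mat (minv g) = Y" if Y: "Y \<in> carrier_mat ?N ?N" for Y
    proof -
      have "transpose_mat g * transpose_mat (minv g) = transpose_mat (minv g * g)"
        by (rule transpose_mult[OF hc gc, symmetric])
      then have 3: "transpose_mat g * transpose_mat (minv g) = 1\<^sub>m ?N" unfolding h by simp
      have "minv g * (g * Y * transpose_mat g) * transpose_mat (minv g)
          = (minv g * g) * Y * (transpose_mat g * transpose_mat (minv g))" using Y gc hc tg by (simp add: as)
      also have "\<dots> = Y" unfolding 3 h using Y by simp
      finally show ?thesis .
    qed
    show ?thesis using arg_cong[OF 2, of "\<lambda>M. minv g * M * transpose_mat (minv g)"]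
      unfolding cancel[OF Et] cancel[OF mult_carrier_mat[OF b Emat_carrier]] .
  qed
  have db: "det b \<noteq> 0" using SL_det[OF Bor_SL[OF bB]] by simp
  obtain p where p: "mat_eval ?N b p * mat_eval ?N b p = b"
    using upper_triangular_sqrt[OF b ub upper_triangular_diag_nz[OF b ub db]] by blast
  define c where "c = mat_eval ?N b p"
  have c: "c \<in> carrier_mat ?N ?N" "upper_triangular c" "c * c = b" "?E * transpose_mat c = c * ?E"
    unfolding c_def using mat_eval_carrier[OF b] mat_eval_upper[OF b ub] p mat_eval_Emat[OF b sym] by auto
  have "g * c * ?E * transpose_mat (g * c) = g * c * (?E * transpose_mat c) * transpose_mat g"
    using gc c(1) tg by (simp add: transpose_mult[OF gc c(1)] as)
  also have "\<dots> = g * (c * c) * ?E * transpose_mat g" unfolding c(4) using gc c(1) tg by (simp add: as)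
  also have "\<dots> = ?E" unfolding c(3) by (rule form)
  finally have sp: "g * c * ?E * transpose_mat (g * c) = ?E" .
  \<comment> \<open>This also gives det c = 1, as membership in \<open>Bor\<close> requires; from c
    c = b alone, only its square is known.\<close>
  have "det (g * c) = 1" by (rule det_symplectic[OF _ sp]) (use gc c in simp)
  then have "g * c \<in> SL n" "det c = 1" using gc c det_mult[OF gc c(1)] SL_det[OF g] by (simp_all add: SL_def)
  then show ?thesis using sp c by (intro bexI[of _ c]) (auto simp: GC_iff Bor_def SL_def)
qed

theorem theorem1p12:
  fixes n :: nat and HC :: "complex mat set"
  assumes "hessC n HC"
  shows "hessA n (HfromC n HC)
     \<and> {y \<in> HfromC n HC. sigma_alg n y = y} = HC
     \<and> (\<forall>x \<in> gC n. phi' n ` HessC n x HC =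
           {F \<in> HessA n x (HfromC n HC). sigma_flag n F = F})"
proof (intro conjI ballI)
  show "hessA n (HfromC n HC)" by (rule hessA_HfromC[OF assms])
  show fixed: "{y \<in> HfromC n HC. sigma_alg n y = y} = HC" by (rule HfromC_fixed[OF assms])
  fix x assume x: "x \<in> gC n"
  show "phi' n ` HessC n x HC = {F \<in> HessA n x (HfromC n HC). sigma_flag n F = F}" (is "?L = ?R")
  proof (intro Set.equalityI Set.subsetI)
    fix F assume "F \<in> ?L"
    then obtain g where g: "g \<in> GC n" "minv g * x * g \<in> HC" "F = phi' n (cosetC n g)"
      by (auto simp: HessC_def)
    have F: "F = cosetA n g" using g phi'_cosetC by simp
    have "sigma_flag n F = F" unfolding F sigma_flag_cosetA[OF GC_SL[OF g(1)]] using g(1) by (simp add: GC_def)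
    moreover have "F \<in> HessA n x (HfromC n HC)"
      unfolding HessA_def F using g GC_SL HC_sub_HfromC[OF assms] by blast
    ultimately show "F \<in> ?R" by simp
  next
    fix F assume "F \<in> ?R"
    then obtain g where g: "g \<in> SL n" "minv g * x * g \<in> HfromC n HC" "F = cosetA n g" "sigma_flag n F = F"
      by (auto simp: HessA_def)
    then have "cosetA n (sigma_grp n g) = cosetA n g" using sigma_flag_cosetA[OF g(1)] by simp
    then obtain c where c: "c \<in> Bor n" "g * c \<in> GC n" using fixed_flag_symplectic[OF g(1)] by blast
    let ?N = "2*n"
    note as = assoc_mult_mat[of _ ?N ?N _ ?N _ ?N] mult_carrier_mat[of _ ?N ?N _ ?N]
    note cS = Bor_SL[OF c(1)]
    note mc = SL_minv[OF cS] and mg = SL_minv[OF g(1)]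
    note carr = SL_carrier[OF cS] SL_carrier[OF g(1)] SL_carrier[OF mc(1)] SL_carrier[OF mg(1)] gC_carrier[OF x]
    have inv: "minv (g * c) = minv c * minv g"
    proof (rule minv_unique[of _ ?N])
      have "g * c * (minv c * minv g) = g * ((c * minv c) * minv g)" using carr by (simp add: as)
      also have "\<dots> = 1\<^sub>m ?N" unfolding mc using carr mg by simp
      finally show "g * c * (minv c * minv g) = 1\<^sub>m ?N" .
    qed (use carr in auto)
    \<comment> \<open>\<open>upper_conj_HfromC\<close> has the inverse on the right, so it is
      applied to \<open>minv c\<close>.\<close>
    have "minv (minv c) = c" using minv_unique[OF carr(3,1) mc(3)] .
    then have "minv c * (minv g * x * g) * c \<in> HfromC n HC"
      using upper_conj_HfromC[OF assms carr(3) _ _ g(2)] Bor_minv[OF c(1)] SL_det[OF mc(1)]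
      by (simp add: Bor_def)
    moreover have "minv c * (minv g * x * g) * c = minv (g * c) * x * (g * c)"
      unfolding inv using carr by (simp add: as)
    ultimately have "minv (g * c) * x * (g * c) \<in> HC"
      using sigma_alg_conj[OF c(2) x] fixed by auto
    then have "cosetC n (g * c) \<in> HessC n x HC" using c(2) unfolding HessC_def by blast
    moreover have "phi' n (cosetC n (g * c)) = F"
      using phi'_cosetC[OF c(2)] cosetA_mult[OF g(1) c(1)] g(3) by simp
    ultimately show "F \<in> ?L" by blast
  qed
qed

end
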